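(* Let $x_0\in\Omega$. For $k\ge1$ write $k=(i-1)M+j$ with $i\ge1$, $1\le j\le M$, and let $x_k=x^i_j$ be the $j$-th sample in the $i$-th iteration of the MP-QMCMC algorithm described in the context, started at $x_0$, where iteration $i$ is driven by $u^i\in(0,1)^{Nd+M}$. Assume that the method is positive Harris with stationary distribution $\pi$ when driven by an IID uniform random seed, that it is regular, and that it has a coupling region $\mathcal C$. Let $$u^i=(v^i_1,\dots,v^i_{Nd+M}),\qquad v^i_\ell:=v_{i(Nd+M)+\ell}\quad (i\ge0,\ \ell=1,\dots,Nd+M),$$ for a completely uniformly distributed (CUD) sequence $(v_i)_{i\ge0}$. Then the sequence $(x_k)_{k\ge1}$ consistently samples $\pi$, i.e. for every bounded continuous $f:\Omega\to\mathbb{R}$, $$\lim_{n\to\infty}\frac1n\sum_{k=1}^nf(x_k)=\int_\Omega f(x)\pi(x)\,dx .$$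
   Context: Let $d,N,M\in\mathbb{N}$, $\Omega\subset\mathbb{R}^d$, and $\pi$ a probability density (the target) on $\Omega$. For $y_{1:N+1}=(y_1,\dots,y_{N+1})\in\Omega^{N+1}$ write $y_{\setminus i}$ for the tuple with $y_i$ removed. For each $y\in\Omega$, $\kappa(y,\cdot)$ is a probability density on $\Omega^N$, and $\Psi_y:(0,1)^{Nd}\to\Omega^N$ is the inverse of its cumulative distribution function (sequential inversion of the one-dimensional conditional CDFs), so that $\Psi_y(U)\sim\kappa(y,\cdot)$ for $U$ uniform on $(0,1)^{Nd}$. MP-QMCMC iteration: given the last accepted sample $y_I=\tilde x$ of the previous iteration ($\tilde x=x_0$ in the first one) and a driving vector $u\in(0,1)^{Nd+M}$: (1) compute the $N$ new proposals $y_{\setminus I}=\Psi_{y_I}(u_1,\dots,u_{Nd})$; (2) compute $p_i=\pi(y_i)\kappa(y_i,y_{\setminus i})/\sum_{j=1}^{N+1}\pi(y_j)\kappa(y_j,y_{\setminus j})$, and $\gamma_0=0$, $\gamma_j=\sum_{i=1}^jp_i$; (3) for $m=1,\dots,M$, set the $m$-th new sample $x_m=y_j$ where $j$ is such that $u_{Nd+m}\in(\gamma_{j-1},\gamma_j]$. The last sample $x_M$ is the starting point of the next iteration. By convention the carried-over sample is placed at position $N+1$ ($I=N+1$) so that the new samples are a function $\phi(\tilde x,u)=(x_1,\dots,x_M)$ of the last sample $\tilde x$ and $u$ only ($\phi$ is called the innovation operator). Coupling region: a set $\mathcal C\subset(0,1)^{Nd+M}$ of positive Jordan measure such that $\phi(x,u)=\phi(x',u)$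 for all $u\in\mathcal C$ and all $x,x'\in\Omega$. Regular: for every $k=(i-1)M+j\ge1$ and every bounded continuous $f:\Omega\to\mathbb{R}$, the function $g(u^1,\dots,u^i)=f(x_k(u^1,\dots,u^i))$ on $(0,1)^{i(Nd+M)}$ is Riemann integrable, where $x_k=x^i_j(u^1,\dots,u^i)$ is the sample as a function of the driving vectors of the first $i$ iterations. CUD: for points $z_1,\dots,z_n\in[0,1]^s$ the star discrepancy is $D^{*s}_n=\sup_{a\in(0,1]^s}\big|\frac1n\sum_{i=1}^n\mathbf 1_{(0,a]}(z_i)-\prod_{i=1}^sa_i\big|$. A sequence $(v_i)_i$ in $(0,1)$ is CUD if for every $s\ge1$ the overlapping blocks $z_i=(v_i,\dots,v_{i+s-1})$ satisfy $D_n^{*s}(z_1,\dots,z_n)\to0$ as $n\to\infty$. Positive Harris means Harris recurrent with an invariant probability distribution. *)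

theory Defs
  imports "HOL-Probability.Probability"
begin

text \<open>
  Vectors whose length depends on \<open>N\<close>, \<open>M\<close>, \<open>i\<close> or \<open>s\<close> are extensional functions on
  \<open>{1..n}\<close>. Points of the state space live in \<open>real ^ 'd\<close>, so the dimension \<open>d\<close> is
  \<open>CARD('d)\<close>; the linear order on \<open>'d\<close> only serves to enumerate the coordinates for the
  sequential inversion of conditional distribution functions.
\<close>

type_synonym 'd point = "(real, 'd) vec"

section \<open>Boxes, Jordan measure and Riemann integrability in dimension n\<close>

definition open_cube :: "nat \<Rightarrow> (nat \<Rightarrow> real) set" where
  "open_cube n = PiE {1..n} (\<lambda>_. {0<..<1})"

type_synonym corners = "(nat \<Rightarrow> real) \<times> (nat \<Rightarrow> real)"

definition nondegenerate :: "nat \<Rightarrow> corners \<Rightarrow> bool" where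
  "nondegenerate n = (\<lambda>(a, b). a \<in> extensional {1..n} \<and> b \<in> extensional {1..n} \<and>
     (\<forall>i\<in>{1..n}. a i < b i))"

definition closed_box :: "nat \<Rightarrow> corners \<Rightarrow> (nat \<Rightarrow> real) set" where
  "closed_box n = (\<lambda>(a, b). PiE {1..n} (\<lambda>i. {a i..b i}))"

definition open_box :: "nat \<Rightarrow> corners \<Rightarrow> (nat \<Rightarrow> real) set" where
  "open_box n = (\<lambda>(a, b). PiE {1..n} (\<lambda>i. {a i<..<b i}))"

definition volume :: "nat \<Rightarrow> corners \<Rightarrow> real" where
  "volume n = (\<lambda>(a, b). \<Prod>i=1..n. b i - a i)"

definition box_family :: "nat \<Rightarrow> corners set \<Rightarrow> bool" where
  "box_family n B \<longleftrightarrow> finite B \<and> (\<forall>c\<in>B. nondegenerate n c)"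

definition nonoverlapping :: "nat \<Rightarrow> corners set \<Rightarrow> bool" where
  "nonoverlapping n B \<longleftrightarrow> (\<forall>c\<in>B. \<forall>c'\<in>B. c \<noteq> c' \<longrightarrow> open_box n c \<inter> open_box n c' = {})"

definition jordan_outer :: "nat \<Rightarrow> (nat \<Rightarrow> real) set \<Rightarrow> real" where
  "jordan_outer n S =
     Inf {\<Sum>c\<in>B. volume n c | B. box_family n B \<and> S \<subseteq> (\<Union>c\<in>B. closed_box n c)}"

definition jordan_inner :: "nat \<Rightarrow> (nat \<Rightarrow> real) set \<Rightarrow> real" where
  "jordan_inner n S =
     Sup {\<Sum>c\<in>B. volume n c | B. box_family n B \<and> nonoverlapping n B \<and>
            (\<Union>c\<in>B. closed_box n c) \<subseteq> S}"

text \<open>Only used for bounded \<open>S\<close>.\<close>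

definition jordan_measurable :: "nat \<Rightarrow> (nat \<Rightarrow> real) set \<Rightarrow> bool" where
  "jordan_measurable n S \<longleftrightarrow> jordan_inner n S = jordan_outer n S"

definition jordan_measure :: "nat \<Rightarrow> (nat \<Rightarrow> real) set \<Rightarrow> real" where
  "jordan_measure n S = jordan_outer n S"

definition cube_division :: "nat \<Rightarrow> corners set \<Rightarrow> bool" where
  "cube_division n B \<longleftrightarrow> box_family n B \<and> nonoverlapping n B \<and>
     (\<Union>c\<in>B. closed_box n c) = PiE {1..n} (\<lambda>_. {0..1})"

text \<open>
  Darboux's criterion. The integrand is only given on the open cube, so suprema and infima
  are taken over the part of each cell lying in it, which is never empty.
\<close>

definition upper_sum :: "nat \<Rightarrow> ((nat \<Rightarrow> real) \<Rightarrow> real) \<Rightarrow> corners set \<Rightarrow> real" where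
  "upper_sum n g B = (\<Sum>c\<in>B. volume n c * Sup (g ` (closed_box n c \<inter> open_cube n)))"

definition lower_sum :: "nat \<Rightarrow> ((nat \<Rightarrow> real) \<Rightarrow> real) \<Rightarrow> corners set \<Rightarrow> real" where
  "lower_sum n g B = (\<Sum>c\<in>B. volume n c * Inf (g ` (closed_box n c \<inter> open_cube n)))"

definition riemann_integrable :: "nat \<Rightarrow> ((nat \<Rightarrow> real) \<Rightarrow> real) \<Rightarrow> bool" where
  "riemann_integrable n g \<longleftrightarrow> bounded (g ` open_cube n) \<and>
     (\<forall>\<epsilon>>0. \<exists>B. cube_division n B \<and> upper_sum n g B - lower_sum n g B < \<epsilon>)"

section \<open>Completely uniformly distributed sequences\<close>

definition star_discrepancy :: "nat \<Rightarrow> nat \<Rightarrow> (nat \<Rightarrow> nat \<Rightarrow> real) \<Rightarrow> real" where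
  "star_discrepancy s n z =
     (SUP a\<in>PiE {1..s} (\<lambda>_. {0<..1}).
        \<bar>(\<Sum>i<n. indicator (PiE {1..s} (\<lambda>j. {0<..a j})) (z i)) / real n - (\<Prod>j=1..s. a j)\<bar>)"

definition CUD :: "(nat \<Rightarrow> real) \<Rightarrow> bool" where
  "CUD v \<longleftrightarrow> (\<forall>i. v i \<in> {0<..<1}) \<and>
     (\<forall>s\<ge>1. (\<lambda>n. star_discrepancy s n (\<lambda>i. \<lambda>j\<in>{1..s}. v (i + (j - 1)))) \<longlonglongrightarrow> 0)"

section \<open>Densities and inverse distribution functions\<close>

definition prob_density :: "'a measure \<Rightarrow> ('a \<Rightarrow> real) \<Rightarrow> bool" where
  "prob_density \<mu> p \<longleftrightarrow> p \<in> borel_measurable \<mu> \<and> (\<forall>x\<in>space \<mu>. 0 \<le> p x) \<and>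
     (\<integral>\<^sup>+x. ennreal (p x) \<partial>\<mu>) = 1"

text \<open>Lebesgue measure on \<open>\<Omega>\<close> and on \<open>\<Omega>\<^sup>N\<close>, and the uniform distribution on \<open>(0,1)\<^sup>n\<close>.\<close>

abbreviation leb_on :: "'a::euclidean_space set \<Rightarrow> 'a measure" where
  "leb_on \<Omega> \<equiv> restrict_space lborel \<Omega>"

abbreviation leb_pow :: "nat \<Rightarrow> 'a::euclidean_space set \<Rightarrow> (nat \<Rightarrow> 'a) measure" where
  "leb_pow N \<Omega> \<equiv> PiM {1..N} (\<lambda>_. leb_on \<Omega>)"

abbreviation unif_cube :: "nat \<Rightarrow> (nat \<Rightarrow> real) measure" where
  "unif_cube n \<equiv> leb_pow n {0<..<1}"

text \<open>
  The identification of \<open>\<real>\<^sup>N\<^sup>d\<close> with \<open>(\<real>\<^sup>d)\<^sup>N\<close>: note that \<open>card {..c}\<close> is the position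
  (counted from 1) of the coordinate \<open>c\<close>.
\<close>

definition unflatten :: "nat \<Rightarrow> (nat \<Rightarrow> real) \<Rightarrow> nat \<Rightarrow> 'd::{finite,linorder} point" where
  "unflatten N w = (\<lambda>n\<in>{1..N}. \<chi> c. w ((n - 1) * CARD('d) + card {..c}))"

text \<open>
  With \<open>q\<close> extended by zero outside \<open>\<Omega>\<^sup>N\<close>, this is the integral of \<open>q\<close> over the coordinates
  \<open>r, r + 1, \<dots>\<close>, the coordinate \<open>r\<close> ranging over \<open>B\<close>, the coordinates before \<open>r\<close> being those
  of \<open>w\<close>. For \<open>B = UNIV\<close> it is the marginal density of the first \<open>r - 1\<close> coordinates.
\<close>

definition tail_integral ::
  "nat \<Rightarrow> 'd::{finite,linorder} point set \<Rightarrow> ((nat \<Rightarrow> 'd point) \<Rightarrow> real) \<Rightarrow>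
   nat \<Rightarrow> (nat \<Rightarrow> real) \<Rightarrow> real set \<Rightarrow> ennreal" where
  "tail_integral N \<Omega> q r w B =
     (\<integral>\<^sup>+s. (let z = unflatten N (\<lambda>i. if i < r then w i else s i)
            in ennreal (q z) * indicator (PiE {1..N} (\<lambda>_. \<Omega>)) z * indicator B (s r))
        \<partial>PiM {r..N * CARD('d)} (\<lambda>_. lborel))"

definition cond_cdf ::
  "nat \<Rightarrow> 'd::{finite,linorder} point set \<Rightarrow> ((nat \<Rightarrow> 'd point) \<Rightarrow> real) \<Rightarrow>
   nat \<Rightarrow> (nat \<Rightarrow> real) \<Rightarrow> real \<Rightarrow> real" where
  "cond_cdf N \<Omega> q r w t =
     enn2real (tail_integral N \<Omega> q r w {..t}) / enn2real (tail_integral N \<Omega> q r w UNIV)"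

text \<open>
  \<open>\<psi>\<close> inverts the conditional distribution functions of \<open>q\<close> one coordinate after the other:
  \<open>F\<^sub>r(w\<^sub>r | w\<^sub>1, \<dots>, w\<^sub>r\<^sub>-\<^sub>1) = u\<^sub>r\<close> where \<open>w\<close> is \<open>\<psi> u\<close> in flattened form. The equation is imposed
  only where the conditional distribution exists, i.e. where the marginal density of
  \<open>w\<^sub>1, \<dots>, w\<^sub>r\<^sub>-\<^sub>1\<close> is positive and finite. No choice of inverse is prescribed where a
  conditional distribution function is not strictly increasing.
\<close>

definition inverse_cdf ::
  "nat \<Rightarrow> 'd::{finite,linorder} point set \<Rightarrow> ((nat \<Rightarrow> 'd point) \<Rightarrow> real) \<Rightarrow>
   ((nat \<Rightarrow> real) \<Rightarrow> nat \<Rightarrow> 'd point) \<Rightarrow> bool" where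
  "inverse_cdf N \<Omega> q \<psi> \<longleftrightarrow>
     (\<forall>u\<in>open_cube (N * CARD('d)). \<psi> u \<in> PiE {1..N} (\<lambda>_. \<Omega>) \<and>
        (\<forall>w. unflatten N w = \<psi> u \<longrightarrow>
          (\<forall>r\<in>{1..N * CARD('d)}.
             0 < tail_integral N \<Omega> q r w UNIV \<and> tail_integral N \<Omega> q r w UNIV < \<infinity> \<longrightarrow>
             cond_cdf N \<Omega> q r w (w r) = u r)))"

section \<open>The multiple proposal algorithm\<close>

definition omit :: "nat \<Rightarrow> nat \<Rightarrow> (nat \<Rightarrow> 'a) \<Rightarrow> nat \<Rightarrow> 'a" where
  "omit N i y = (\<lambda>k\<in>{1..N}. if k < i then y k else y (k + 1))"

definition selection_prob ::
  "nat \<Rightarrow> ('a \<Rightarrow> real) \<Rightarrow> ('a \<Rightarrow> (nat \<Rightarrow> 'a) \<Rightarrow> real) \<Rightarrow> (nat \<Rightarrow> 'a) \<Rightarrow> nat \<Rightarrow> real" where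
  "selection_prob N \<pi> \<kappa> y i =
     \<pi> (y i) * \<kappa> (y i) (omit N i y) / (\<Sum>j=1..N+1. \<pi> (y j) * \<kappa> (y j) (omit N j y))"

definition cumulative_prob ::
  "nat \<Rightarrow> ('a \<Rightarrow> real) \<Rightarrow> ('a \<Rightarrow> (nat \<Rightarrow> 'a) \<Rightarrow> real) \<Rightarrow> (nat \<Rightarrow> 'a) \<Rightarrow> nat \<Rightarrow> real" where
  "cumulative_prob N \<pi> \<kappa> y j = (\<Sum>i=1..j. selection_prob N \<pi> \<kappa> y i)"

definition selects ::
  "nat \<Rightarrow> ('a \<Rightarrow> real) \<Rightarrow> ('a \<Rightarrow> (nat \<Rightarrow> 'a) \<Rightarrow> real) \<Rightarrow> (nat \<Rightarrow> 'a) \<Rightarrow> real \<Rightarrow> nat \<Rightarrow> bool" where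
  "selects N \<pi> \<kappa> y t j \<longleftrightarrow> j \<in> {1..N+1} \<and>
     t \<in> {cumulative_prob N \<pi> \<kappa> y (j - 1) <.. cumulative_prob N \<pi> \<kappa> y j}"

definition ensemble ::
  "nat \<Rightarrow> ('d::{finite,linorder} point \<Rightarrow> (nat \<Rightarrow> real) \<Rightarrow> nat \<Rightarrow> 'd point) \<Rightarrow>
   'd point \<Rightarrow> (nat \<Rightarrow> real) \<Rightarrow> nat \<Rightarrow> 'd point" where
  "ensemble N \<Psi> x u =
     (\<lambda>i\<in>{1..N+1}. if i = N + 1 then x else \<Psi> x (restrict u {1..N * CARD('d)}) i)"

text \<open>
  The innovation operator. For \<open>t \<in> (0,1)\<close> exactly one index is selected, except when all the
  products \<open>\<pi>(y\<^sub>j) \<kappa>(y\<^sub>j, y\<^sub>\<setminus>\<^sub>j)\<close> vanish, so that the weights are undefined; by convention the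
  algorithm then stays at \<open>x\<close>.
\<close>

definition innovation ::
  "nat \<Rightarrow> nat \<Rightarrow> ('d::{finite,linorder} point \<Rightarrow> real) \<Rightarrow>
   ('d point \<Rightarrow> (nat \<Rightarrow> 'd point) \<Rightarrow> real) \<Rightarrow>
   ('d point \<Rightarrow> (nat \<Rightarrow> real) \<Rightarrow> nat \<Rightarrow> 'd point) \<Rightarrow>
   'd point \<Rightarrow> (nat \<Rightarrow> real) \<Rightarrow> nat \<Rightarrow> 'd point" where
  "innovation N M \<pi> \<kappa> \<Psi> x u =
     (\<lambda>m\<in>{1..M}.
        let y = ensemble N \<Psi> x u; t = u (N * CARD('d) + m)
        in if \<exists>j. selects N \<pi> \<kappa> y t j then y (THE j. selects N \<pi> \<kappa> y t j) else x)"

text \<open>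
  The recursion \<open>X\<^sub>i = h(X\<^sub>i\<^sub>-\<^sub>1, U\<^sub>i)\<close>, \<open>i \<ge> 1\<close>; the entry \<open>U 0\<close> is never used.
\<close>

primrec recursion :: "('a \<Rightarrow> 'u \<Rightarrow> 'a) \<Rightarrow> 'a \<Rightarrow> (nat \<Rightarrow> 'u) \<Rightarrow> nat \<Rightarrow> 'a" where
  "recursion h x U 0 = x"
| "recursion h x U (Suc i) = h (recursion h x U i) (U (Suc i))"

text \<open>The sample \<open>x\<^sup>i\<^sub>j\<close>, for an innovation operator \<open>\<phi>\<close> and \<open>i \<ge> 1\<close>, \<open>1 \<le> j \<le> M\<close>.\<close>

definition mp_sample ::
  "nat \<Rightarrow> ('a \<Rightarrow> 'u \<Rightarrow> nat \<Rightarrow> 'a) \<Rightarrow> 'a \<Rightarrow> (nat \<Rightarrow> 'u) \<Rightarrow> nat \<Rightarrow> nat \<Rightarrow> 'a" where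
  "mp_sample M \<phi> x0 U i j = \<phi> (recursion (\<lambda>x u. \<phi> x u M) x0 U (i - 1)) (U i) j"

definition coupling_region ::
  "nat \<Rightarrow> 'a set \<Rightarrow> ('a \<Rightarrow> (nat \<Rightarrow> real) \<Rightarrow> nat \<Rightarrow> 'a) \<Rightarrow> (nat \<Rightarrow> real) set \<Rightarrow> bool" where
  "coupling_region D \<Omega> \<phi> C \<longleftrightarrow>
     C \<subseteq> open_cube D \<and> jordan_measurable D C \<and> 0 < jordan_measure D C \<and>
     (\<forall>u\<in>C. \<forall>x\<in>\<Omega>. \<forall>x'\<in>\<Omega>. \<phi> x u = \<phi> x' u)"

definition regular ::
  "nat \<Rightarrow> nat \<Rightarrow> 'a::topological_space set \<Rightarrow> ('a \<Rightarrow> (nat \<Rightarrow> real) \<Rightarrow> nat \<Rightarrow> 'a) \<Rightarrow> 'a \<Rightarrow> bool"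
  where
  "regular D M \<Omega> \<phi> x0 \<longleftrightarrow>
     (\<forall>i\<ge>1. \<forall>j\<in>{1..M}. \<forall>f :: 'a \<Rightarrow> real. continuous_on \<Omega> f \<and> bounded (f ` \<Omega>) \<longrightarrow>
        riemann_integrable (i * D)
          (\<lambda>w. f (mp_sample M \<phi> x0 (\<lambda>h. \<lambda>l\<in>{1..D}. w ((h - 1) * D + l)) i j)))"

section \<open>Positive Harris recurrence\<close>

text \<open>
  The Markov chain on \<open>S\<close> generated by the recursion with map \<open>h\<close> and i.i.d. seeds of law \<open>R\<close>.
  It is Harris recurrent if it is \<open>\<psi>\<close>-irreducible for some nontrivial \<open>\<sigma>\<close>-finite \<open>\<psi>\<close> such that
  every set \<open>A\<close> of positive \<open>\<psi>\<close>-measure is visited infinitely often, almost surely, from every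
  starting point in \<open>A\<close>.
\<close>

definition harris_recurrent :: "'a measure \<Rightarrow> 'u measure \<Rightarrow> ('a \<Rightarrow> 'u \<Rightarrow> 'a) \<Rightarrow> bool" where
  "harris_recurrent S R h \<longleftrightarrow>
     (\<exists>\<psi>. sigma_finite_measure \<psi> \<and> sets \<psi> = sets S \<and> 0 < emeasure \<psi> (space \<psi>) \<and>
        (\<forall>A\<in>sets S. 0 < emeasure \<psi> A \<longrightarrow>
           (\<forall>x\<in>space S. 0 < emeasure (PiM (UNIV :: nat set) (\<lambda>_. R))
              {U \<in> space (PiM (UNIV :: nat set) (\<lambda>_. R)). \<exists>i\<ge>1. recursion h x U i \<in> A}) \<and>
           (\<forall>x\<in>A. AE U in PiM (UNIV :: nat set) (\<lambda>_. R). infinite {i. recursion h x U i \<in> A})))"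

definition invariant_distribution ::
  "'a measure \<Rightarrow> 'u measure \<Rightarrow> ('a \<Rightarrow> 'u \<Rightarrow> 'a) \<Rightarrow> 'a measure \<Rightarrow> bool" where
  "invariant_distribution S R h \<mu> \<longleftrightarrow> prob_space \<mu> \<and> sets \<mu> = sets S \<and>
     (\<forall>A\<in>sets S. (\<integral>\<^sup>+x. emeasure R {u \<in> space R. h x u \<in> A} \<partial>\<mu>) = emeasure \<mu> A)"

definition positive_harris ::
  "'a measure \<Rightarrow> 'u measure \<Rightarrow> ('a \<Rightarrow> 'u \<Rightarrow> 'a) \<Rightarrow> 'a measure \<Rightarrow> bool" where
  "positive_harris S R h \<mu> \<longleftrightarrow> harris_recurrent S R h \<and> invariant_distribution S R h \<mu>"

end

theory Submission
  imports Defs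
begin

text \<open>
  Let \<open>H\<close> be a half-open box of volume \<open>p > 0\<close> inside the coupling region. Whenever one of the last \<open>m\<close>
  driving vectors lies in \<open>H\<close>, the current sample is a function \<open>g\<^sub>m\<close> of these \<open>m\<close> vectors alone: it is
  the sample obtained by restarting the algorithm at \<open>x\<^sub>0\<close> just before them. By regularity \<open>f \<circ> g\<^sub>m\<close> is
  Riemann integrable, so its averages along the driving sequence converge to its integral, which
  differs from \<open>\<integral> f d\<pi>\<close> by at most \<open>2 (1 - p)\<^sup>m sup \<bar>f\<bar>\<close>, because \<open>\<pi>\<close> is invariant and the transition operator
  contracts oscillations by the factor \<open>1 - p\<close>. That \<open>\<pi>\<close> is the mean for all \<open>M\<close> samples of an iteration, not only for the last
  one, follows by exchanging two coordinates of the driving vector.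

  The definition of CUD speaks of overlapping blocks, the algorithm reads disjoint ones. A second
  moment argument bridges the gap: averages over \<open>L\<close> distant shifts of a centred box indicator have mean
  square of order \<open>1 / L\<close> along all positions, hence of order \<open>D / L\<close> along the multiples of \<open>D\<close>. The
  same bound, applied to \<open>m\<close> consecutive blocks, shows that driving vectors avoid \<open>H\<close> during \<open>m\<close>
  iterations with frequency of order \<open>1 / m\<close> only.
\<close>

section \<open>Cesaro limits\<close>

definition cesaro_lim :: "(nat \<Rightarrow> real) \<Rightarrow> real \<Rightarrow> bool" where
  "cesaro_lim a L \<longleftrightarrow> (\<lambda>n. (\<Sum>i<n. a i) / real n) \<longlonglongrightarrow> L"

lemma cesaro_lim_add:
  "cesaro_lim a K \<Longrightarrow> cesaro_lim b L \<Longrightarrow> cesaro_lim (\<lambda>i. a i + b i) (K + L)"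
  unfolding cesaro_lim_def by (drule (1) tendsto_add) (simp add: sum.distrib add_divide_distrib)

lemma cesaro_lim_cmult: "cesaro_lim a K \<Longrightarrow> cesaro_lim (\<lambda>i. c * a i) (c * K)"
  unfolding cesaro_lim_def by (drule tendsto_mult_left[of _ _ _ c]) (simp add: sum_distrib_left)

lemma cesaro_lim_const: "cesaro_lim (\<lambda>i. c) c"
  unfolding cesaro_lim_def
proof (rule tendsto_eventually)
  show "\<forall>\<^sub>F n in sequentially. (\<Sum>i<n. c) / real n = c"
    using eventually_gt_at_top[of 0] by eventually_elim simp
qed

lemma cesaro_lim_diff:
  "cesaro_lim a K \<Longrightarrow> cesaro_lim b L \<Longrightarrow> cesaro_lim (\<lambda>i. a i - b i) (K - L)"
  using cesaro_lim_add[of a K "\<lambda>i. (-1) * b i" "(-1) * L"] cesaro_lim_cmult[of b L "-1"] by simp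

lemma cesaro_lim_sum:
  assumes "\<And>k. k \<in> A \<Longrightarrow> cesaro_lim (a k) (K k)"
  shows "cesaro_lim (\<lambda>i. \<Sum>k\<in>A. a k i) (\<Sum>k\<in>A. K k)"
  using assms
proof (induction A rule: infinite_finite_induct)
  case (insert x F)
  then show ?case using cesaro_lim_add[of "a x" "K x"] by simp
qed (simp_all add: cesaro_lim_const)

lemma cesaro_lim_minus_iff: "cesaro_lim (\<lambda>i. a i - L) 0 \<longleftrightarrow> cesaro_lim a L"
  using cesaro_lim_diff[OF _ cesaro_lim_const, of a L L]
    cesaro_lim_add[OF _ cesaro_lim_const, of "\<lambda>i. a i - L" 0 L] by auto

text \<open>A shift by \<open>k\<close> exchanges the first \<open>k\<close> terms for
  \<open>k\<close> terms past the end, so the two sums differ by at most \<open>2 * B * k\<close>.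
  Convergence of the averages is not assumed, which allows the use for sequences whose averages are
  only known to be bounded.\<close>

lemma averages_shift_diff:
  fixes a :: "nat \<Rightarrow> real"
  assumes bd: "\<And>i. \<bar>a i\<bar> \<le> B"
  shows "(\<lambda>n. (\<Sum>i<n. a i) / real n - (\<Sum>i<n. a (i + k)) / real n) \<longlonglongrightarrow> 0"
proof (rule Lim_null_comparison)
  show "(\<lambda>n. 2 * B * k / real n) \<longlonglongrightarrow> 0"
    by (rule lim_const_over_n)
  have "\<bar>(\<Sum>i<n. a i) - (\<Sum>i<n. a (i + k))\<bar> \<le> 2 * B * k" for n
  proof (induction k)
    case (Suc k)
    have "(\<Sum>i<n. a (i + k)) - (\<Sum>i<n. a (i + Suc k)) = a k - a (n + k)"
      by (induction n) auto
    then show ?case using Suc bd[of k] bd[of "n + k"] by (auto simp: algebra_simps)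
  qed simp
  then show "\<forall>\<^sub>F n in sequentially.
      norm ((\<Sum>i<n. a i) / real n - (\<Sum>i<n. a (i + k)) / real n) \<le> 2 * B * k / real n"
    by (intro always_eventually allI)
      (auto simp: diff_divide_distrib[symmetric] intro!: divide_right_mono)
qed

lemma cesaro_lim_shift:
  assumes "\<And>i. \<bar>a i\<bar> \<le> B"
  shows "cesaro_lim (\<lambda>i. a (i + k)) L \<longleftrightarrow> cesaro_lim a L"
proof -
  have "(\<lambda>n. (\<Sum>i<n. a i) / real n - (\<Sum>i<n. a (i + k)) / real n) \<longlonglongrightarrow> 0"
    using assms by (rule averages_shift_diff)
  from tendsto_add[OF this, of "\<lambda>n. (\<Sum>i<n. a (i + k)) / real n" L]
    tendsto_diff[OF _ this, of "\<lambda>n. (\<Sum>i<n. a i) / real n" L]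
  show ?thesis unfolding cesaro_lim_def by auto
qed

text \<open>Reassembles the samples of an iteration: the first \<open>n\<close> terms are
  \<open>n div M\<close> complete rows of length \<open>M\<close> and fewer than \<open>M\<close>
  further terms, whose contribution vanishes after division by \<open>n\<close>.\<close>

lemma cesaro_lim_residues:
  assumes bd: "\<And>i. \<bar>s i\<bar> \<le> B" and M: "M \<ge> 1"
    and res: "\<And>j. j < M \<Longrightarrow> cesaro_lim (\<lambda>i. s (i * M + j)) L"
  shows "cesaro_lim s L"
proof -
  \<comment> \<open>With limit 0 the quotient by \<open>n\<close> can simply be bounded by the
    larger quotient by \<open>n div M\<close>, the number of complete rows.\<close>
  define r where "r i = s i - L" for i
  have bdr: "\<bar>r i\<bar> \<le> B + \<bar>L\<bar>" for i
    using bd[of i] unfolding r_def by linarith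
  have "cesaro_lim (\<lambda>i. \<Sum>j<M. r (i * M + j)) (\<Sum>j<M. 0)"
    unfolding r_def by (intro cesaro_lim_sum) (simp add: cesaro_lim_minus_iff res)
  then have 1: "(\<lambda>n. (\<Sum>i<n. \<Sum>j<M. r (i * M + j)) / real n) \<longlonglongrightarrow> 0"
    unfolding cesaro_lim_def by simp
  have blocks: "(\<Sum>i<q. \<Sum>j<M. r (i * M + j)) = (\<Sum>k<q * M. r k)" for q
  proof (induction q)
    case (Suc q)
    have "{..<M + q * M} = {..<q * M} \<union> {q * M..<M + q * M}" by auto
    moreover have "(\<Sum>k = q * M..<M + q * M. r k) = (\<Sum>j<M. r (q * M + j))"
      using sum.shift_bounds_nat_ivl[of r 0 "q * M" M]
      by (simp add: atLeast0LessThan add.commute)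
    moreover have "sum r ({..<q * M} \<union> {q * M..<M + q * M})
        = sum r {..<q * M} + sum r {q * M..<M + q * M}"
      by (rule sum.union_disjoint) auto
    ultimately show ?case using Suc by simp
  qed simp
  have fl: "filterlim (\<lambda>n. n div M) at_top sequentially"
    using M by (auto simp: filterlim_at_top eventually_at_top_linorder
        intro!: exI[of _ "_ * M"] simp: less_eq_div_iff_mult_less_eq)
  have "(\<lambda>n. \<bar>(\<Sum>k<n div M * M. r k) / real (n div M)\<bar> + M * (B + \<bar>L\<bar>) / real n) \<longlonglongrightarrow> 0 + 0"
    using filterlim_compose[OF tendsto_rabs_zero[OF 1[unfolded blocks]] fl]
    by (intro tendsto_add lim_const_over_n) simp_all
  moreover have "\<forall>\<^sub>F n in sequentially. norm ((\<Sum>k<n. r k) / real n)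
      \<le> \<bar>(\<Sum>k<n div M * M. r k) / real (n div M)\<bar> + M * (B + \<bar>L\<bar>) / real n"
    using eventually_ge_at_top[of M]
  proof eventually_elim
    case (elim n)
    define q where "q = n div M"
    have q: "q * M \<le> n" "n < q * M + M" "q \<ge> 1"
      using M elim dividend_less_div_times[of M n]
      by (auto simp: q_def div_greater_zero_iff Suc_le_eq add.commute)
    have qn: "q \<le> n" using q(1) M by (metis le_trans mult.right_neutral mult_le_mono2)
    have split: "{..<n} = {..<q * M} \<union> {q * M..<n}" using q by auto
    have "\<bar>\<Sum>k = q * M..<n. r k\<bar> \<le> (\<Sum>k = q * M..<n. B + \<bar>L\<bar>)"
      by (rule order_trans[OF sum_abs sum_mono]) (rule bdr)
    also have "\<dots> \<le> M * (B + \<bar>L\<bar>)"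
      using q(1) of_nat_less_iff[of n "q * M + M", where 'a = real] q(2) bdr[of 0]
      by (auto intro!: mult_right_mono)
    finally have tail: "\<bar>\<Sum>k = q * M..<n. r k\<bar> \<le> M * (B + \<bar>L\<bar>)" .
    have "\<bar>\<Sum>k<n. r k\<bar> \<le> \<bar>\<Sum>k<q * M. r k\<bar> + M * (B + \<bar>L\<bar>)"
      using tail by (simp add: split sum.union_disjoint ivl_disj_int)
    then have "\<bar>\<Sum>k<n. r k\<bar> / n \<le> \<bar>\<Sum>k<q * M. r k\<bar> / n + M * (B + \<bar>L\<bar>) / n"
      by (simp add: divide_right_mono add_divide_distrib[symmetric])
    also have "\<bar>\<Sum>k<q * M. r k\<bar> / n \<le> \<bar>\<Sum>k<q * M. r k\<bar> / q"
      using q qn by (intro divide_left_mono) auto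
    finally show ?case by (simp add: q_def)
  qed
  ultimately have "cesaro_lim r 0"
    unfolding cesaro_lim_def by (intro Lim_null_comparison[of "\<lambda>n. (\<Sum>i<n. r i) / real n"]) simp_all
  then show ?thesis unfolding r_def by (simp add: cesaro_lim_minus_iff)
qed

section \<open>Second moments of averages over shifts, and passage to multiples of
  \<open>D\<close>\<close>

text \<open>Expanding the square leaves \<open>L\<close> diagonal terms, each at most 1, and
  off-diagonal products whose averages tend to 0. Division by \<open>L\<close> squared gives
  \<open>1 / L\<close> from the diagonal; the second \<open>1 / L\<close> absorbs the off-diagonal
  sum, which is eventually below \<open>L\<close>.\<close>

lemma averages_of_squares_le:
  assumes bd: "\<And>t. \<bar>Y t\<bar> \<le> 1" and L: "L \<ge> 1"
    and mix: "\<And>k. k \<ge> 1 \<Longrightarrow> cesaro_lim (\<lambda>t. Y t * Y (t + k * r)) 0"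
  shows "\<forall>\<^sub>F n in sequentially. (\<Sum>t<n. ((\<Sum>l<L. Y (t + l * r)) / L)\<^sup>2) / real n \<le> 2 / real L"
proof -
  define pairs where "pairs = {..<L} \<times> {..<L} - (\<lambda>l. (l, l)) ` {..<L}"
  have bd2: "\<bar>Y t * Y t'\<bar> \<le> 1" for t t'
    using bd[of t] bd[of t'] by (simp add: abs_mult mult_le_one)
  have mixl: "cesaro_lim (\<lambda>t. Y (t + l * r) * Y (t + l' * r)) 0" if "l < l'" for l l'
  proof -
    have "cesaro_lim (\<lambda>t. Y (t + l * r) * Y (t + l * r + (l' - l) * r)) 0"
      using cesaro_lim_shift[of "\<lambda>t. Y t * Y (t + (l' - l) * r)" 1 "l * r" 0] bd2 mix that by simp
    then show ?thesis using that by (simp add: algebra_simps diff_mult_distrib)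
  qed
  have off: "cesaro_lim (\<lambda>t. \<Sum>(l, l')\<in>pairs. Y (t + l * r) * Y (t + l' * r)) (\<Sum>p\<in>pairs. 0)"
    unfolding split_beta
  proof (rule cesaro_lim_sum)
    fix p assume "p \<in> pairs"
    then have "fst p < snd p \<or> snd p < fst p" unfolding pairs_def by auto
    then show "cesaro_lim (\<lambda>t. Y (t + fst p * r) * Y (t + snd p * r)) 0"
      using mixl[of "fst p" "snd p"] mixl[of "snd p" "fst p"] by (auto simp: mult.commute)
  qed
  have sq: "((\<Sum>l<L. Y (t + l * r)) / L)\<^sup>2
      \<le> ((\<Sum>(l, l')\<in>pairs. Y (t + l * r) * Y (t + l' * r)) + L) / L\<^sup>2" for t
  proof -
    have "(\<Sum>l<L. Y (t + l * r))\<^sup>2 = (\<Sum>(l, l')\<in>{..<L} \<times> {..<L}. Y (t + l * r) * Y (t + l' * r))"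
      by (simp add: power2_eq_square sum_product sum.cartesian_product)
    also have "\<dots> = (\<Sum>(l, l')\<in>pairs. Y (t + l * r) * Y (t + l' * r))
        + (\<Sum>(l, l')\<in>(\<lambda>l. (l, l)) ` {..<L}. Y (t + l * r) * Y (t + l' * r))"
      unfolding pairs_def by (rule sum.subset_diff) auto
    also have "(\<Sum>(l, l')\<in>(\<lambda>l. (l, l)) ` {..<L}. Y (t + l * r) * Y (t + l' * r))
        = (\<Sum>l<L. Y (t + l * r) * Y (t + l * r))"
      by (subst sum.reindex) (auto simp: inj_on_def)
    also have "\<dots> \<le> (\<Sum>l<L. 1)"
      using bd2 by (intro sum_mono) (metis abs_le_D1)
    finally show ?thesis by (simp add: power_divide divide_right_mono)
  qed
  have "\<forall>\<^sub>F n in sequentially.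
      (\<Sum>t<n. \<Sum>(l, l')\<in>pairs. Y (t + l * r) * Y (t + l' * r)) / real n < L"
    using off L unfolding cesaro_lim_def by (intro order_tendstoD(2)) auto
  then show ?thesis
    using eventually_gt_at_top[of 0]
  proof eventually_elim
    case (elim n)
    let ?S = "\<Sum>t<n. \<Sum>(l, l')\<in>pairs. Y (t + l * r) * Y (t + l' * r)"
    have "(\<Sum>t<n. ((\<Sum>l<L. Y (t + l * r)) / L)\<^sup>2)
        \<le> (\<Sum>t<n. ((\<Sum>(l, l')\<in>pairs. Y (t + l * r) * Y (t + l' * r)) + L) / L\<^sup>2)"
      by (rule sum_mono) (rule sq)
    also have "\<dots> = (?S + n * L) / L\<^sup>2"
      by (simp add: sum_divide_distrib[symmetric] sum.distrib)
    also have "\<dots> \<le> (n * L + n * L) / L\<^sup>2"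
      using elim by (intro divide_right_mono add_right_mono) (auto simp: field_simps)
    also have "\<dots> = n * (2 / L)"
      using L by (simp add: power2_eq_square field_simps)
    finally show ?case using elim by (simp add: field_simps)
  qed
qed

text \<open>For nonnegative terms the sum over the multiples of \<open>D\<close> is at most the sum
  over all positions below \<open>n * D\<close>; normalising by \<open>n\<close> instead of
  \<open>n * D\<close> costs the factor \<open>D\<close>. This is why second moments are transferred
  to the sparse positions, and not the signed averages themselves.\<close>

lemma averages_sparse_le:
  fixes G :: "nat \<Rightarrow> real"
  assumes G: "\<And>t. 0 \<le> G t" and D: "D \<ge> 1"
    and ev: "\<forall>\<^sub>F n in sequentially. (\<Sum>t<n. G t) / real n \<le> c"
  shows "\<forall>\<^sub>F n in sequentially. (\<Sum>i<n. G (i * D)) / real n \<le> D * c"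
proof -
  have "filterlim (\<lambda>n. n * D) sequentially sequentially"
    using D by (simp add: filterlim_at_top_mono[OF filterlim_ident] mult_le_cancel1)
  then have "\<forall>\<^sub>F n in sequentially. (\<Sum>t<n * D. G t) / real (n * D) \<le> c"
    using ev by (rule eventually_compose_filterlim[rotated])
  then show ?thesis
    using eventually_gt_at_top[of 0]
  proof eventually_elim
    case (elim n)
    have "(\<Sum>i<n. G (i * D)) = (\<Sum>t\<in>(\<lambda>i. i * D) ` {..<n}. G t)"
      using D by (subst sum.reindex) (auto simp: inj_on_def)
    also have "\<dots> \<le> (\<Sum>t<n * D. G t)"
      using D G by (intro sum_mono2) auto
    finally show ?case using elim D by (simp add: field_simps) 
  qed
qed

text \<open>Shifts by multiples of \<open>n0 * D\<close> preserve the positions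
  \<open>i * D\<close>, so the average may be replaced by its mean over \<open>L\<close> such
  shifts. That mean is small by Cauchy-Schwarz and the second moment bound. The spacing
  \<open>n0\<close> leaves room for sequences that decorrelate only at a distance.\<close>

lemma cesaro_lim_sparse:
  assumes bd: "\<And>t. \<bar>Y t\<bar> \<le> 1" and D: "D \<ge> 1"
    and mix: "\<And>k. k \<ge> 1 \<Longrightarrow> cesaro_lim (\<lambda>t. Y t * Y (t + k * (n0 * D))) 0"
  shows "cesaro_lim (\<lambda>i. Y (i * D)) 0"
  unfolding cesaro_lim_def
proof (rule LIMSEQ_I, simp only: diff_zero)
  fix e :: real assume e: "e > 0"
  \<comment> \<open>\<open>8 * D / e\<^sup>2\<close> is the threshold beyond which the second moment
    bound \<open>D * (2 / L)\<close> drops below the square of \<open>e / 2\<close>; the other half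
    of \<open>e\<close> is kept for the error of shifting.\<close>
  obtain L :: nat where L: "8 * D / e\<^sup>2 < real L" using reals_Archimedean2 by blast
  have "0 \<le> 8 * D / e\<^sup>2" by simp
  with L have L1: "L \<ge> 1" by linarith
  have L2: "D * (2 / real L) < (e/2)\<^sup>2"
    using L L1 e by (simp add: field_simps power2_eq_square)
  have ev1: "\<forall>\<^sub>F n in sequentially.
      (\<Sum>i<n. ((\<Sum>l<L. Y (i * D + l * (n0 * D))) / L)\<^sup>2) / real n \<le> D * (2 / L)"
    using averages_sparse_le[OF _ D averages_of_squares_le[OF bd L1 mix]] by simp
  have shift: "(\<lambda>n. (\<Sum>i<n. Y (i * D)) / real n - (\<Sum>i<n. Y ((i + k) * D)) / real n) \<longlonglongrightarrow> 0" for k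
    by (rule averages_shift_diff[of "\<lambda>i. Y (i * D)"]) (rule bd)
  have "(\<lambda>n. (\<Sum>l<L. (\<Sum>i<n. Y (i * D)) / real n - (\<Sum>i<n. Y ((i + l * n0) * D)) / real n) / L)
      \<longlonglongrightarrow> (\<Sum>l<L. 0) / L"
    using L1 by (intro tendsto_intros tendsto_sum shift) auto
  then have "(\<lambda>n. (\<Sum>l<L. (\<Sum>i<n. Y (i * D)) / real n - (\<Sum>i<n. Y ((i + l * n0) * D)) / real n) / L)
      \<longlonglongrightarrow> 0" by simp
  then have ev2: "\<forall>\<^sub>F n in sequentially.
      \<bar>(\<Sum>l<L. (\<Sum>i<n. Y (i * D)) / real n - (\<Sum>i<n. Y ((i + l * n0) * D)) / real n) / L\<bar> < e/2"
    using e by (auto simp: tendsto_iff dist_real_def elim!: allE[of _ "e/2"])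
  have "\<forall>\<^sub>F n in sequentially. norm ((\<Sum>i<n. Y (i * D)) / real n) < e"
    using ev1 ev2 eventually_gt_at_top[of 0]
  proof eventually_elim
    case (elim n)
    \<comment> \<open>The square of the mean of \<open>Z\<close> is at most the mean of its squares,
      by Cauchy-Schwarz.\<close>
    define Z where "Z i = (\<Sum>l<L. Y (i * D + l * (n0 * D))) / L" for i
    have "(\<Sum>i<n. Z i)\<^sup>2 \<le> (\<Sum>i<n. (Z i)\<^sup>2) * n"
      using sum_squared_le_sum_of_squares[of Z "{..<n}"] by simp
    then have "((\<Sum>i<n. Z i) / n)\<^sup>2 \<le> (\<Sum>i<n. (Z i)\<^sup>2) / n"
      using elim by (simp add: power_divide power2_eq_square field_simps)
    also have "\<dots> < (e/2)\<^sup>2"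
      using elim L2 unfolding Z_def by linarith
    finally have "\<bar>(\<Sum>i<n. Z i) / n\<bar> < e/2"
      using e by (intro power2_less_imp_less[of _ "e/2"]) (simp_all only: power2_abs)
    moreover have "(\<Sum>i<n. Z i) = (\<Sum>l<L. \<Sum>i<n. Y ((i + l * n0) * D)) / L"
      unfolding Z_def by (subst sum.swap) (simp add: sum_divide_distrib[symmetric] algebra_simps)
    then have "(\<Sum>l<L. (\<Sum>i<n. Y (i * D)) / real n - (\<Sum>i<n. Y ((i + l * n0) * D)) / real n) / L
        = (\<Sum>i<n. Y (i * D)) / n - (\<Sum>i<n. Z i) / n"
      using L1 by (simp add: sum_subtractf diff_divide_distrib sum_divide_distrib[symmetric])
    ultimately show ?case using elim(2) unfolding real_norm_def by linarith
  qed
  then show "\<exists>no. \<forall>n\<ge>no. norm ((\<Sum>i<n. Y (i * D)) / real n) < e"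
    unfolding eventually_sequentially .
qed

section \<open>Frequencies of boxes along CUD sequences\<close>

lemma prod_indicator_bounds:
  "0 \<le> (\<Prod>j\<in>I. indicator (A j) (w j) :: real)" "(\<Prod>j\<in>I. indicator (A j) (w j) :: real) \<le> 1"
  "\<bar>\<Prod>j\<in>I. indicator (A j) (w j) :: real\<bar> \<le> 1"
  by (auto intro!: prod_nonneg prod_le_1 simp: abs_prod)

text \<open>The deviation for a single anchored box is one of the values under the supremum in the
  star discrepancy. The supremum dominates it because all these values are at most 1.\<close>

lemma CUD_anchored_boxes:
  assumes v: "CUD v" and b: "\<And>j. j \<in> {1..s} \<Longrightarrow> 0 \<le> b j \<and> b j \<le> 1"
  shows "cesaro_lim (\<lambda>t. \<Prod>j=1..s. indicator {0<..b j} (v (t + (j - 1)))) (\<Prod>j=1..s. b j)"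
proof (cases "s \<ge> 1 \<and> (\<forall>j\<in>{1..s}. 0 < b j)")
  case False
  \<comment> \<open>Boxes with an empty side do not occur in the supremum, and the discrepancy
    condition starts at dimension 1. In both cases the product is constant.\<close>
  then consider "s = 0" | j where "j \<in> {1..s}" "b j = 0"
    using b by force
  then show ?thesis
  proof cases
    case 2
    then have "(\<lambda>t. \<Prod>j=1..s. indicator {0<..b j} (v (t + (j - 1)))) = (\<lambda>t. 0::real)"
      by (intro ext prod_zero bexI[of _ j]) auto
    moreover have "(\<Prod>j=1..s. b j) = 0"
      using 2 by (intro prod_zero) auto
    ultimately show ?thesis by (metis cesaro_lim_const)
  qed (simp add: cesaro_lim_const)
next
  case True
  define z where "z i = (\<lambda>j\<in>{1..s}. v (i + (j - 1)))" for i
  define err where "err n a = \<bar>(\<Sum>i<n. indicator (PiE {1..s} (\<lambda>j. {0<..a j})) (z i)) / real n - (\<Prod>j=1..s. a j)\<bar>"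
    for n a
  have "err n a \<le> 1" if "a \<in> PiE {1..s} (\<lambda>_. {0<..1})" for n a
  proof -
    have "(\<Sum>i<n. indicator (PiE {1..s} (\<lambda>j. {0<..a j})) (z i) :: real) \<le> (\<Sum>i<n. 1)"
      by (intro sum_mono) (auto simp: indicator_def)
    then have "(\<Sum>i<n. indicator (PiE {1..s} (\<lambda>j. {0<..a j})) (z i)) / real n \<le> 1"
      by (auto simp: divide_le_eq)
    moreover have "0 \<le> (\<Sum>i<n. indicator (PiE {1..s} (\<lambda>j. {0<..a j})) (z i)) / real n"
      by (intro divide_nonneg_nonneg sum_nonneg) auto
    moreover have "0 \<le> (\<Prod>j=1..s. a j)" "(\<Prod>j=1..s. a j) \<le> 1"
      using PiE_mem[OF that] by (auto intro!: prod_nonneg prod_le_1 simp: less_imp_le)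
    ultimately show ?thesis unfolding err_def by linarith
  qed
  then have bdd: "bdd_above (err n ` PiE {1..s} (\<lambda>_. {0<..1}))" for n
    by (intro bdd_aboveI[of _ 1]) auto
  have rb: "restrict b {1..s} \<in> PiE {1..s} (\<lambda>_. {0<..1})"
    using True b by auto
  define dev where "dev n = (\<Sum>i<n. indicator (PiE {1..s} (\<lambda>j. {0<..restrict b {1..s} j})) (z i)) / real n
      - (\<Prod>j=1..s. restrict b {1..s} j)" for n
  have "norm (dev n) \<le> star_discrepancy s n z" for n
  proof -
    have "norm (dev n) = err n (restrict b {1..s})"
      by (simp only: err_def dev_def real_norm_def)
    moreover have "star_discrepancy s n z = (SUP a\<in>PiE {1..s} (\<lambda>_. {0<..1}). err n a)"
      by (simp only: star_discrepancy_def err_def)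
    ultimately show ?thesis using cSUP_upper[OF rb bdd, of n] by (simp only:)
  qed
  then have "\<forall>\<^sub>F n in sequentially. norm (dev n) \<le> star_discrepancy s n z"
    by (intro always_eventually allI)
  moreover have "(\<lambda>n. star_discrepancy s n z) \<longlonglongrightarrow> 0"
    using v True unfolding CUD_def z_def by blast
  ultimately have "dev \<longlonglongrightarrow> 0"
    by (rule Lim_null_comparison)
  moreover have "dev = (\<lambda>n. (\<Sum>t<n. \<Prod>j=1..s. indicator {0<..b j} (v (t + (j - 1)))) / real n - (\<Prod>j=1..s. b j))"
  proof
    fix n
    have "indicator (PiE {1..s} (\<lambda>j. {0<..restrict b {1..s} j})) (z t)
        = (\<Prod>j=1..s. indicator {0<..b j} (v (t + (j - 1))) :: real)" for t
    proof (cases "\<forall>j\<in>{1..s}. v (t + (j - 1)) \<in> {0<..b j}")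
      case True
      then have "z t \<in> PiE {1..s} (\<lambda>j. {0<..restrict b {1..s} j})"
        unfolding z_def by (simp add: PiE_iff)
      then show ?thesis using True by simp
    next
      case False
      then obtain j where j: "j \<in> {1..s}" "v (t + (j - 1)) \<notin> {0<..b j}" by blast
      then have "z t \<notin> PiE {1..s} (\<lambda>j. {0<..restrict b {1..s} j})"
        unfolding z_def by (auto simp: PiE_iff)
      moreover have "(\<Prod>j=1..s. indicator {0<..b j} (v (t + (j - 1))) :: real) = 0"
        using j by (intro prod_zero bexI[of _ j]) auto
      ultimately show ?thesis by simp
    qed
    moreover have "(\<Prod>j=1..s. restrict b {1..s} j) = (\<Prod>j=1..s. b j)"
      by (rule prod.cong) simp_all
    ultimately show "dev n = (\<Sum>t<n. \<Prod>j=1..s. indicator {0<..b j} (v (t + (j - 1)))) / real n - (\<Prod>j=1..s. b j)"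
      by (simp only: dev_def)
  qed
  ultimately show ?thesis
    unfolding cesaro_lim_def by - (rule LIM_zero_cancel, simp only:)
qed

text \<open>
  Induction on the set \<open>J\<close> of coordinates with a nonzero lower bound, which are removed one at a time
  by \<open>(a, b] = (0, b] - (0, a]\<close>.
\<close>

lemma CUD_boxes_unshifted:
  assumes v: "CUD v" and "finite J"
    and "\<And>j. j \<in> {1..s} \<Longrightarrow> 0 \<le> a j \<and> a j \<le> b j \<and> b j \<le> 1" and "\<And>j. j \<in> {1..s} - J \<Longrightarrow> a j = 0"
  shows "cesaro_lim (\<lambda>t. \<Prod>j=1..s. indicator {a j<..b j} (v (t + (j - 1)))) (\<Prod>j=1..s. b j - a j)"
  using assms(2-)
proof (induction J arbitrary: a b rule: finite_induct)
  case empty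
  then have "(\<Prod>j=1..s. indicator {a j<..b j} (v (t + (j - 1))) :: real)
      = (\<Prod>j=1..s. indicator {0<..b j} (v (t + (j - 1))))" for t
    by (intro prod.cong) auto
  moreover have "(\<Prod>j=1..s. b j - a j) = (\<Prod>j=1..s. b j)"
    using empty by (intro prod.cong) auto
  moreover have "cesaro_lim (\<lambda>t. \<Prod>j=1..s. indicator {0<..b j} (v (t + (j - 1)))) (\<Prod>j=1..s. b j)"
  proof (rule CUD_anchored_boxes[OF v])
    fix j assume "j \<in> {1..s}"
    then show "0 \<le> b j \<and> b j \<le> 1" using empty(1)[of j] by auto
  qed
  ultimately show ?case by simp
next
  case (insert k J)
  show ?case
  proof (cases "k \<in> {1..s}")
    case False
    then show ?thesis using insert.prems by (intro insert.IH) auto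
  next
    case True
    let ?a = "a(k := 0)" and ?b = "b(k := a k)"
    note ab = insert.prems(1)
    have 1: "cesaro_lim (\<lambda>t. \<Prod>j=1..s. indicator {?a j<..b j} (v (t + (j - 1)))) (\<Prod>j=1..s. b j - ?a j)"
      using insert.prems(2) ab by (intro insert.IH) (auto intro: order_trans)
    have 2: "cesaro_lim (\<lambda>t. \<Prod>j=1..s. indicator {?a j<..?b j} (v (t + (j - 1)))) (\<Prod>j=1..s. ?b j - ?a j)"
      using insert.prems(2) ab by (intro insert.IH) (auto intro: order_trans)
    have fin: "finite {1..s}" by simp
    have "(\<Prod>j=1..s. indicator {a j<..b j} (v (t + (j - 1))) :: real)
        = (\<Prod>j=1..s. indicator {?a j<..b j} (v (t + (j - 1))))
          - (\<Prod>j=1..s. indicator {?a j<..?b j} (v (t + (j - 1))))" for t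
    proof -
      have "indicator {a k<..b k} (v (t + (k - 1)))
          = (indicator {0<..b k} (v (t + (k - 1))) - indicator {0<..a k} (v (t + (k - 1))) :: real)"
        using ab[OF True] by (auto simp: indicator_def)
      moreover have "(\<Prod>j\<in>{1..s} - {k}. indicator {?a j<..b j} (v (t + (j - 1))) :: real)
          = (\<Prod>j\<in>{1..s} - {k}. indicator {a j<..b j} (v (t + (j - 1))))"
        "(\<Prod>j\<in>{1..s} - {k}. indicator {?a j<..?b j} (v (t + (j - 1))) :: real)
          = (\<Prod>j\<in>{1..s} - {k}. indicator {a j<..b j} (v (t + (j - 1))))"
        by (intro prod.cong; simp)+
      ultimately show ?thesis
        unfolding prod.remove[OF fin True] by (simp add: left_diff_distrib)
    qed
    moreover have "(\<Prod>j=1..s. b j - a j) = (\<Prod>j=1..s. b j - ?a j) - (\<Prod>j=1..s. ?b j - ?a j)"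
    proof -
      have "(\<Prod>j\<in>{1..s} - {k}. b j - ?a j) = (\<Prod>j\<in>{1..s} - {k}. b j - a j)"
        "(\<Prod>j\<in>{1..s} - {k}. ?b j - ?a j) = (\<Prod>j\<in>{1..s} - {k}. b j - a j)"
        by (intro prod.cong; simp)+
      then show ?thesis
        unfolding prod.remove[OF fin True] by (simp add: left_diff_distrib)
    qed
    ultimately show ?thesis using cesaro_lim_diff[OF 1 2] by simp
  qed
qed

lemma CUD_boxes:
  assumes v: "CUD v" and ab: "\<And>j. j \<in> {1..s} \<Longrightarrow> 0 \<le> a j \<and> a j \<le> b j \<and> b j \<le> 1"
  shows "cesaro_lim (\<lambda>t. \<Prod>j=1..s. indicator {a j<..b j} (v (t + j))) (\<Prod>j=1..s. b j - a j)"
proof -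
  let ?X = "\<lambda>t. \<Prod>j=1..s. indicator {a j<..b j} (v (t + (j - 1))) :: real"
  have "cesaro_lim ?X (\<Prod>j=1..s. b j - a j)"
    using ab by (intro CUD_boxes_unshifted[OF v, of "{1..s}"]) auto
  then have "cesaro_lim (\<lambda>t. ?X (t + 1)) (\<Prod>j=1..s. b j - a j)"
    by (subst cesaro_lim_shift[of ?X 1]) (rule prod_indicator_bounds)
  moreover have "?X (t + 1) = (\<Prod>j=1..s. indicator {a j<..b j} (v (t + j)))" for t
    by (intro prod.cong) auto
  ultimately show ?thesis by simp
qed

text \<open>For \<open>s \<le> k\<close> the windows at \<open>t\<close> and \<open>t + k\<close>
  are disjoint, so the product of the two indicators is the indicator of one box in dimension
  \<open>k + s\<close>, with volume \<open>p * p\<close>. Complete uniform distribution in every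
  dimension is what makes this available for every \<open>k\<close>.\<close>

lemma CUD_boxes_uncorrelated:
  assumes v: "CUD v" and ab: "\<And>j. j \<in> {1..s} \<Longrightarrow> 0 \<le> a j \<and> a j \<le> b j \<and> b j \<le> 1"
    and k: "s \<le> k"
  defines "p \<equiv> \<Prod>j=1..s. b j - a j"
  defines "Y \<equiv> \<lambda>t. (\<Prod>j=1..s. indicator {a j<..b j} (v (t + j))) - p"
  shows "cesaro_lim (\<lambda>t. Y t * Y (t + k)) 0"
proof -
  define X where "X t = (\<Prod>j=1..s. indicator {a j<..b j} (v (t + j)) :: real)" for t
  have X: "cesaro_lim X p"
    unfolding X_def p_def by (rule CUD_boxes[OF v ab])
  have Xk: "cesaro_lim (\<lambda>t. X (t + k)) p"
    using X by (subst cesaro_lim_shift[of X 1]) (simp_all add: X_def prod_indicator_bounds)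
  \<comment> \<open>The coordinates in the gap between the two windows range over
    \<open>{0<..1}\<close>: their indicators equal 1 along \<open>v\<close> and their side lengths
    are 1.\<close>
  define a' where "a' j = (if j \<le> s then a j else if j \<le> k then 0 else a (j - k))" for j
  define b' where "b' j = (if j \<le> s then b j else if j \<le> k then 1 else b (j - k))" for j
  have split: "(\<Prod>j=1..k+s. F j) = (\<Prod>j=1..s. F j) * (\<Prod>j=s+1..k. F j) * (\<Prod>j=1..s. F (j + k))"
    for F :: "nat \<Rightarrow> real"
  proof -
    have "{1..k} = {1..s} \<union> {s+1..k}" using k by auto
    then have "(\<Prod>j=1..k. F j) = (\<Prod>j=1..s. F j) * (\<Prod>j=s+1..k. F j)"
      using prod.union_disjoint[of "{1..s}" "{s+1..k}" F] by simp
    moreover have "{1..k+s} = {1..k} \<union> {1+k..s+k}" by auto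
    then have "(\<Prod>j=1..k+s. F j) = (\<Prod>j=1..k. F j) * (\<Prod>j=1+k..s+k. F j)"
      using prod.union_disjoint[of "{1..k}" "{1+k..s+k}" F] by simp
    ultimately have "(\<Prod>j=1..k+s. F j) = (\<Prod>j=1..s. F j) * (\<Prod>j=s+1..k. F j) * (\<Prod>j=1+k..s+k. F j)"
      by simp
    then show ?thesis by (simp only: prod.shift_bounds_cl_nat_ivl)
  qed
  have v01: "0 < v i" "v i \<le> 1" for i
    using v unfolding CUD_def by (auto simp: less_imp_le)
  have "cesaro_lim (\<lambda>t. \<Prod>j=1..k+s. indicator {a' j<..b' j} (v (t + j))) (\<Prod>j=1..k+s. b' j - a' j)"
  proof (rule CUD_boxes[OF v])
    fix j assume "j \<in> {1..k + s}"
    then have "j \<le> s \<and> j \<in> {1..s} \<or> j \<le> k \<and> \<not> j \<le> s \<or> \<not> j \<le> s \<and> \<not> j \<le> k \<and> j - k \<in> {1..s}"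
      using k by auto
    then show "0 \<le> a' j \<and> a' j \<le> b' j \<and> b' j \<le> 1"
      using ab[of j] ab[of "j - k"] unfolding a'_def b'_def by (elim disjE conjE) (simp_all only: if_True if_False, simp_all)
  qed
  moreover have "(\<Prod>j=1..k+s. indicator {a' j<..b' j} (v (t + j))) = X t * X (t + k)" for t
  proof -
    have "(\<Prod>j=1..s. indicator {a' j<..b' j} (v (t + j))) = X t"
      unfolding X_def a'_def b'_def by (intro prod.cong) auto
    moreover have "(\<Prod>j=s+1..k. indicator {a' j<..b' j} (v (t + j)) :: real) = 1"
      using v01 by (intro prod.neutral) (auto simp: a'_def b'_def)
    moreover have "(\<Prod>j=1..s. indicator {a' (j + k)<..b' (j + k)} (v (t + (j + k)))) = X (t + k)"
      unfolding X_def a'_def b'_def using k by (intro prod.cong) (auto simp: ac_simps)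
    ultimately show ?thesis unfolding split by simp
  qed
  moreover have "(\<Prod>j=1..k+s. b' j - a' j) = p * p"
  proof -
    have "(\<Prod>j=1..s. b' j - a' j) = p"
      unfolding p_def a'_def b'_def by (intro prod.cong) auto
    moreover have "(\<Prod>j=s+1..k. b' j - a' j) = 1"
      by (intro prod.neutral) (auto simp: a'_def b'_def)
    moreover have "(\<Prod>j=1..s. b' (j + k) - a' (j + k)) = p"
      unfolding p_def a'_def b'_def using k by (intro prod.cong) auto
    ultimately show ?thesis unfolding split by simp
  qed
  ultimately have "cesaro_lim (\<lambda>t. X t * X (t + k)) (p * p)" by simp
  from cesaro_lim_add[OF cesaro_lim_diff[OF cesaro_lim_diff[OF this cesaro_lim_cmult[OF X, of p]]
        cesaro_lim_cmult[OF Xk, of p]] cesaro_lim_const[of "p * p"]]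
  show ?thesis unfolding Y_def X_def[symmetric] by (simp add: algebra_simps)
qed

lemma box_deviation_le_1:
  fixes a b w :: "nat \<Rightarrow> real"
  assumes ab: "\<And>j. j \<in> {1..s} \<Longrightarrow> 0 \<le> a j \<and> a j \<le> b j \<and> b j \<le> 1"
  shows "\<bar>(\<Prod>j=1..s. indicator {a j<..b j} (w j)) - (\<Prod>j=1..s. b j - a j)\<bar> \<le> 1"
proof -
  have "0 \<le> (\<Prod>j=1..s. b j - a j)" "(\<Prod>j=1..s. b j - a j) \<le> 1"
    using ab by (auto intro!: prod_nonneg prod_le_1) (meson diff_le_eq order_trans add_increasing2)+
  then show ?thesis
    using prod_indicator_bounds(1,2)[where I = "{1..s}" and A = "\<lambda>j. {a j<..b j}" and w = w] by linarith
qed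

text \<open>The bridge from overlapping to disjoint blocks; \<open>s\<close> may be any multiple of
  \<open>D\<close>, as needed for windows of several driving vectors.\<close>

lemma CUD_boxes_sparse:
  assumes v: "CUD v" and ab: "\<And>j. j \<in> {1..s} \<Longrightarrow> 0 \<le> a j \<and> a j \<le> b j \<and> b j \<le> 1" and D: "D \<ge> 1"
  shows "cesaro_lim (\<lambda>i. \<Prod>j=1..s. indicator {a j<..b j} (v (i * D + j))) (\<Prod>j=1..s. b j - a j)"
proof -
  define Y where "Y t = (\<Prod>j=1..s. indicator {a j<..b j} (v (t + j))) - (\<Prod>j=1..s. b j - a j)" for t
  have "cesaro_lim (\<lambda>i. Y (i * D)) 0"
  proof (rule cesaro_lim_sparse[OF _ D])
    show "\<bar>Y t\<bar> \<le> 1" for t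
      unfolding Y_def by (rule box_deviation_le_1[OF ab])
    \<comment> \<open>The spacing \<open>s * D\<close> is a multiple of \<open>D\<close> and at
      least \<open>s\<close>, so shifted windows of length \<open>s\<close> never overlap.\<close>
    fix k :: nat assume "k \<ge> 1"
    then have "s * 1 \<le> k * (s * D)" using D by (simp add: mult_le_mono)
    then show "cesaro_lim (\<lambda>t. Y t * Y (t + k * (s * D))) 0"
      unfolding Y_def by (intro CUD_boxes_uncorrelated[OF v ab]) auto
  qed
  then show ?thesis unfolding Y_def by (simp only: cesaro_lim_minus_iff)
qed

text \<open>For a box in the dimension \<open>D\<close> of one driving vector, shifts by
  \<open>D\<close> already give disjoint windows. The inner sum therefore runs over \<open>L\<close>
  consecutive iterations and controls how long the driving vectors can avoid the box.\<close>

lemma CUD_boxes_second_moment: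
  assumes v: "CUD v" and ab: "\<And>j. j \<in> {1..D} \<Longrightarrow> 0 \<le> a j \<and> a j \<le> b j \<and> b j \<le> 1"
    and D: "D \<ge> 1" and L: "L \<ge> 1"
  defines "p \<equiv> \<Prod>j=1..D. b j - a j"
  shows "\<forall>\<^sub>F n in sequentially. (\<Sum>i<n. ((\<Sum>l<L. (\<Prod>j=1..D. indicator {a j<..b j} (v ((i + l) * D + j))) - p) / L)\<^sup>2) / real n
      \<le> D * (2 / L)"
proof -
  define Y where "Y t = (\<Prod>j=1..D. indicator {a j<..b j} (v (t + j))) - p" for t
  have "\<forall>\<^sub>F n in sequentially. (\<Sum>t<n. ((\<Sum>l<L. Y (t + l * D)) / L)\<^sup>2) / real n \<le> 2 / real L"
  proof (rule averages_of_squares_le[OF _ L])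
    show "\<bar>Y t\<bar> \<le> 1" for t
      unfolding Y_def p_def by (rule box_deviation_le_1[OF ab])
    fix k :: nat assume "k \<ge> 1"
    then show "cesaro_lim (\<lambda>t. Y t * Y (t + k * D)) 0"
      unfolding Y_def p_def by (intro CUD_boxes_uncorrelated[OF v ab]) auto
  qed
  from averages_sparse_le[OF _ D this]
  show ?thesis unfolding Y_def by (simp add: add_mult_distrib add.assoc)
qed

section \<open>Riemann integrable functions along box-equidistributed sequences\<close>

text \<open>Half-open sides match the boxes counted by the discrepancy and let adjacent cells of a
  division tile without overlap. The product form factorises under integration and needs no
  extensionality of \<open>w\<close>.\<close>

definition half_open_ind :: "nat \<Rightarrow> corners \<Rightarrow> (nat \<Rightarrow> real) \<Rightarrow> real" where
  "half_open_ind n c w = (\<Prod>j=1..n. indicator {fst c j<..snd c j} (w j))"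

lemma half_open_ind_eq:
  "half_open_ind n c w = (if \<forall>j\<in>{1..n}. fst c j < w j \<and> w j \<le> snd c j then 1 else 0)"
proof (cases "\<forall>j\<in>{1..n}. fst c j < w j \<and> w j \<le> snd c j")
  case False
  then obtain j where "j \<in> {1..n}" "w j \<notin> {fst c j<..snd c j}" by auto
  then have "half_open_ind n c w = 0"
    unfolding half_open_ind_def by (intro prod_zero bexI[of _ j]) auto
  then show ?thesis using False by simp
qed (auto simp: half_open_ind_def)

lemma prob_space_unif: "prob_space (leb_on {0<..<1::real})"
  by (rule prob_spaceI) (simp add: space_restrict_space emeasure_restrict_space)

lemma prob_space_unif_cube: "prob_space (unif_cube n)"
  by (rule prob_space_PiM) (rule prob_space_unif)

lemma space_unif_cube: "space (unif_cube n) = open_cube n"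
  by (simp add: space_PiM space_restrict_space open_cube_def)

lemma integral_unif_interval:
  assumes "0 \<le> a" "a \<le> b" "b \<le> (1::real)"
  shows "integrable (leb_on {0<..<1}) (indicator {a<..b} :: real \<Rightarrow> real)"
    and "(\<integral>x. indicator {a<..b} x \<partial>leb_on {0<..<1}) = b - a"
proof -
  interpret prob_space "leb_on {0<..<1::real}" by (rule prob_space_unif)
  have m: "{a<..b} \<inter> {0<..<1} \<in> sets (leb_on {0<..<1})"
    by (simp add: sets_restrict_space_iff)
  \<comment> \<open>The open interval omits 1, so for \<open>b = 1\<close> the intersection loses an
    endpoint, which has measure zero.\<close>
  have eq: "{a<..b} \<inter> {0<..<1} = (if b < 1 then {a<..b} else {a<..<1})"
    using assms by auto
  have *: "integrable (leb_on {0<..<1}) (indicator {a<..b} :: real \<Rightarrow> real) \<longleftrightarrow>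
      integrable (leb_on {0<..<1}) (indicator ({a<..b} \<inter> {0<..<1}) :: real \<Rightarrow> real)"
    by (intro Bochner_Integration.integrable_cong refl) (auto simp: space_restrict_space indicator_def)
  show "integrable (leb_on {0<..<1}) (indicator {a<..b} :: real \<Rightarrow> real)"
    unfolding * using m by (intro integrable_real_indicator) (auto simp: emeasure_eq_measure)
  have "(\<integral>x. indicator {a<..b} x \<partial>leb_on {0<..<1}) =
      (\<integral>x. indicator ({a<..b} \<inter> {0<..<1}) x \<partial>leb_on {0<..<1::real} :: real)"
    by (intro Bochner_Integration.integral_cong) (auto simp: space_restrict_space indicator_def)
  also have "\<dots> = measure (leb_on {0<..<1}) ({a<..b} \<inter> {0<..<1})"
    using m by (simp add: space_restrict_space Int_absorb2)
  also have "\<dots> = measure lborel ({a<..b} \<inter> {0<..<1})"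
    by (intro measure_restrict_space) auto
  also have "\<dots> = b - a"
    unfolding eq using assms by auto
  finally show "(\<integral>x. indicator {a<..b} x \<partial>leb_on {0<..<1}) = b - a" .
qed

lemma integral_half_open_ind:
  assumes "\<And>j. j \<in> {1..n} \<Longrightarrow> 0 \<le> fst c j \<and> fst c j \<le> snd c j \<and> snd c j \<le> 1"
  shows "integrable (unif_cube n) (half_open_ind n c)"
    and "(\<integral>w. half_open_ind n c w \<partial>unif_cube n) = (\<Prod>j=1..n. snd c j - fst c j)"
proof -
  interpret product_prob_space "\<lambda>_::nat. leb_on {0<..<1::real}" "{1..n}"
    by (rule product_prob_spaceI) (rule prob_space_unif)
  have i: "integrable (leb_on {0<..<1}) (indicator {fst c j<..snd c j} :: real \<Rightarrow> real)"
    "(\<integral>x. indicator {fst c j<..snd c j} x \<partial>leb_on {0<..<1::real}) = snd c j - fst c j"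
    if "j \<in> {1..n}" for j
    using integral_unif_interval[of "fst c j" "snd c j"] assms[OF that] by auto
  show "integrable (unif_cube n) (half_open_ind n c)"
    unfolding half_open_ind_def using i by (intro product_integrable_prod) auto
  show "(\<integral>w. half_open_ind n c w \<partial>unif_cube n) = (\<Prod>j=1..n. snd c j - fst c j)"
    unfolding half_open_ind_def using i by (subst product_integral_prod) auto
qed

text \<open>The corners are themselves points of the closed cell, being extensional by
  nondegeneracy, and the cell lies in the unit cube.\<close>

lemma cube_division_corners:
  assumes "cube_division n B" "c \<in> B" "j \<in> {1..n}"
  shows "0 \<le> fst c j" "fst c j < snd c j" "snd c j \<le> 1"
proof -
  obtain a b where c: "c = (a, b)" by (cases c)
  have nd: "nondegenerate n (a, b)" and sub: "closed_box n (a, b) \<subseteq> PiE {1..n} (\<lambda>_. {0..1})"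
    using assms unfolding cube_division_def box_family_def c by blast+
  have "a \<in> closed_box n (a, b)" "b \<in> closed_box n (a, b)"
    using nd unfolding nondegenerate_def closed_box_def by (auto simp: PiE_iff less_imp_le)
  then have "a \<in> PiE {1..n} (\<lambda>_. {0..1})" "b \<in> PiE {1..n} (\<lambda>_. {0..1})"
    using sub by blast+
  then show "0 \<le> fst c j" "fst c j < snd c j" "snd c j \<le> 1"
    using nd assms(3) unfolding nondegenerate_def c by (auto simp: PiE_iff)
qed

lemma eventually_diff_at_right_0:
  "x < y \<Longrightarrow> \<forall>\<^sub>F e in at_right 0. x < y - (e::real)"
  by (rule eventually_at_rightI[of 0 "y - x"]) auto

text \<open>
  The closed cells overlap on their faces, but the half-open ones partition the cube: moving a
  point of the cube slightly towards the origin puts it into the interior of the half-open cells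
  that contain it.
\<close>

lemma cube_division_half_open:
  assumes B: "cube_division n B" and w: "w \<in> open_cube n"
  obtains c where "c \<in> B" "w \<in> closed_box n c"
    "\<And>F. (\<Sum>c\<in>B. F c * half_open_ind n c w) = (F c :: real)"
proof -
  define ho where "ho c \<longleftrightarrow> (\<forall>j\<in>{1..n}. fst c j < w j \<and> w j \<le> snd c j)" for c :: corners
  define p where "p e = (\<lambda>j\<in>{1..n}. w j - e)" for e
  have fin: "finite B" using B unfolding cube_division_def box_family_def by blast
  have pos: "\<forall>\<^sub>F e in at_right (0::real). 0 < e"
    by (rule eventually_at_right_less)
  have "\<exists>c\<in>B. ho c"
  proof (rule ccontr)
    \<comment> \<open>Each of the finitely many closed cells is missed by \<open>p e\<close> for all
      small \<open>e\<close>, also when \<open>w\<close> lies on its lower face, since the shift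
      leaves through that face. Yet \<open>p e\<close> stays in the unit cube, which the cells
      cover.\<close>
    assume none: "\<not> (\<exists>c\<in>B. ho c)"
    have "\<forall>\<^sub>F e in at_right 0. \<forall>c\<in>B. p e \<notin> closed_box n c"
    proof (rule eventually_ball_finite[OF fin], rule ballI)
      fix c assume "c \<in> B"
      then obtain j where j: "j \<in> {1..n}" "w j \<le> fst c j \<or> snd c j < w j"
        using none unfolding ho_def by force
      have "\<forall>\<^sub>F e in at_right 0. p e j < fst c j \<or> snd c j < p e j"
      proof (cases "w j \<le> fst c j")
        case True
        show ?thesis using pos by eventually_elim (use True j in \<open>auto simp: p_def\<close>)
      next
        case False
        then have "snd c j < w j" using j by auto
        from eventually_diff_at_right_0[OF this] show ?thesis
          by eventually_elim (use j in \<open>auto simp: p_def\<close>)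
      qed
      then show "\<forall>\<^sub>F e in at_right 0. p e \<notin> closed_box n c"
        by eventually_elim (use j in \<open>force simp: closed_box_def split_beta PiE_iff\<close>)
    qed
    moreover have "\<forall>\<^sub>F e in at_right 0. \<forall>j\<in>{1..n}. 0 < w j - e"
      using w by (intro eventually_ball_finite ballI eventually_diff_at_right_0)
        (auto simp: open_cube_def PiE_iff)
    ultimately have "\<forall>\<^sub>F e in at_right (0::real). False"
      using pos
    proof eventually_elim
      case (elim e)
      have "w j < 1" if "j \<in> {1..n}" for j
        using w that by (auto simp: open_cube_def PiE_iff)
      then have "p e \<in> PiE {1..n} (\<lambda>_. {0..1})"
        using elim by (fastforce simp: p_def PiE_iff)
      then show ?case using B elim(1) unfolding cube_division_def by blast
    qed
    then show False by simp
  qed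
  then obtain c where c: "c \<in> B" "ho c" by blast
  \<comment> \<open>For small \<open>e\<close> the shifted point lies in the interiors of both
    cells, which are disjoint.\<close>
  have uniq: "c' = c" if c': "c' \<in> B" "ho c'" for c'
  proof (rule ccontr)
    assume "c' \<noteq> c"
    then have disj: "open_box n c' \<inter> open_box n c = {}"
      using B c c' unfolding cube_division_def nonoverlapping_def by blast
    have op: "\<forall>\<^sub>F e in at_right 0. p e \<in> open_box n d" if "ho d" for d
    proof -
      have "\<forall>\<^sub>F e in at_right 0. \<forall>j\<in>{1..n}. fst d j < w j - e"
        using that by (intro eventually_ball_finite ballI eventually_diff_at_right_0)
          (auto simp: ho_def)
      then show ?thesis using pos
      proof eventually_elim
        case (elim e)
        have "w j - e < snd d j" if "j \<in> {1..n}" for j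
          using \<open>ho d\<close> that elim(2) unfolding ho_def by force
        then show ?case
          using elim by (auto simp: open_box_def split_beta PiE_iff p_def)
      qed
    qed
    have "\<forall>\<^sub>F e in at_right (0::real). False"
      using op[OF c'(2)] op[OF c(2)] by eventually_elim (use disj in blast)
    then show False by simp
  qed
  show ?thesis
  proof (rule that[OF c(1)])
    show "w \<in> closed_box n c"
      using c(2) w by (auto simp: closed_box_def split_beta PiE_iff ho_def open_cube_def less_imp_le)
    show "(\<Sum>c\<in>B. F c * half_open_ind n c w) = F c" for F
    proof -
      have "half_open_ind n d w = (if d = c then 1 else 0)" if "d \<in> B" for d
      proof (cases "ho d")
        case True
        then show ?thesis using uniq[OF that] unfolding half_open_ind_eq ho_def by simp
      next
        case False
        then have "d \<noteq> c" using c by blast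
        with False show ?thesis unfolding half_open_ind_eq ho_def by simp
      qed
      then have "(\<Sum>d\<in>B. F d * half_open_ind n d w) = (\<Sum>d\<in>B. if d = c then F d else 0)"
        by (intro sum.cong) simp_all
      then show ?thesis using c fin by simp
    qed
  qed
qed

text \<open>Darboux step functions enclose \<open>g\<close>; their averages converge to the lower
  and upper sums by \<open>boxes\<close>, and these sums also enclose the integral. Borel
  measurability is a separate assumption because Riemann integrability gives Lebesgue measurability
  only.\<close>

lemma riemann_integrable_cesaro_lim:
  assumes g: "riemann_integrable n g" and meas: "g \<in> borel_measurable (unif_cube n)"
    and W: "\<And>i. W i \<in> open_cube n"
    and boxes: "\<And>c. (\<And>j. j \<in> {1..n} \<Longrightarrow> 0 \<le> fst c j \<and> fst c j \<le> snd c j \<and> snd c j \<le> 1) \<Longrightarrow>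
        cesaro_lim (\<lambda>i. half_open_ind n c (W i)) (\<Prod>j=1..n. snd c j - fst c j)"
  shows "cesaro_lim (\<lambda>i. g (W i)) (\<integral>w. g w \<partial>unif_cube n)"
  unfolding cesaro_lim_def
proof (rule LIMSEQ_I)
  fix e :: real assume e: "e > 0"
  interpret prob_space "unif_cube n" by (rule prob_space_unif_cube)
  have bdd: "bounded (g ` open_cube n)" using g unfolding riemann_integrable_def by blast
  \<comment> \<open>Half of \<open>e\<close> is spent on the gap between the Darboux sums, half on
    the convergence of the step function averages.\<close>
  obtain B where B: "cube_division n B" "upper_sum n g B - lower_sum n g B < e / 2"
    using g e unfolding riemann_integrable_def by (meson half_gt_zero)
  define cell where "cell c = closed_box n c \<inter> open_cube n" for c
  have bd: "bdd_above (g ` cell c)" "bdd_below (g ` cell c)" for c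
    using bounded_subset[OF bdd, of "g ` cell c"] unfolding cell_def
    by (auto intro!: bounded_imp_bdd_above bounded_imp_bdd_below)
  define lo where "lo w = (\<Sum>c\<in>B. Inf (g ` cell c) * half_open_ind n c w)" for w
  define up where "up w = (\<Sum>c\<in>B. Sup (g ` cell c) * half_open_ind n c w)" for w
  have sandwich: "lo w \<le> g w" "g w \<le> up w" if w: "w \<in> open_cube n" for w
  proof -
    obtain c where c: "w \<in> closed_box n c"
      and F: "\<And>F. (\<Sum>c\<in>B. F c * half_open_ind n c w) = (F c :: real)"
      using cube_division_half_open[OF B(1) w] by blast
    have "w \<in> cell c" using c w unfolding cell_def by blast
    then show "lo w \<le> g w" "g w \<le> up w"
      unfolding lo_def up_def F using bd by (simp_all add: cInf_lower cSup_upper)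
  qed
  have corners: "0 \<le> fst c j \<and> fst c j \<le> snd c j \<and> snd c j \<le> 1" if "c \<in> B" "j \<in> {1..n}" for c j
    using cube_division_corners[OF B(1) that] by auto
  have vol: "volume n c = (\<Prod>j=1..n. snd c j - fst c j)" for c
    by (simp add: volume_def split_beta)
  have "cesaro_lim (\<lambda>i. lo (W i)) (\<Sum>c\<in>B. Inf (g ` cell c) * volume n c)"
    unfolding lo_def vol using corners by (intro cesaro_lim_sum cesaro_lim_cmult boxes) blast
  then have lo_lim: "cesaro_lim (\<lambda>i. lo (W i)) (lower_sum n g B)"
    unfolding lower_sum_def cell_def by (simp add: mult.commute)
  have "cesaro_lim (\<lambda>i. up (W i)) (\<Sum>c\<in>B. Sup (g ` cell c) * volume n c)"
    unfolding up_def vol using corners by (intro cesaro_lim_sum cesaro_lim_cmult boxes) blast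
  then have up_lim: "cesaro_lim (\<lambda>i. up (W i)) (upper_sum n g B)"
    unfolding upper_sum_def cell_def by (simp add: mult.commute)
  have int: "integrable (unif_cube n) (half_open_ind n c)"
    "(\<integral>w. half_open_ind n c w \<partial>unif_cube n) = volume n c" if "c \<in> B" for c
    using integral_half_open_ind[of n c] corners that unfolding vol by blast+
  have lo_int: "integrable (unif_cube n) lo" "(\<integral>w. lo w \<partial>unif_cube n) = lower_sum n g B"
    unfolding lo_def lower_sum_def cell_def[symmetric] using int by (auto simp: mult.commute)
  have up_int: "integrable (unif_cube n) up" "(\<integral>w. up w \<partial>unif_cube n) = upper_sum n g B"
    unfolding up_def upper_sum_def cell_def[symmetric] using int by (auto simp: mult.commute)
  obtain K where K: "\<And>w. w \<in> open_cube n \<Longrightarrow> norm (g w) \<le> K"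
    using bdd unfolding bounded_iff by blast
  have g_int: "integrable (unif_cube n) g"
    using K by (intro integrable_const_bound[of _ K] meas AE_I2) (simp only: space_unif_cube)
  have lower: "lower_sum n g B \<le> (\<integral>w. g w \<partial>unif_cube n)"
    unfolding lo_int(2)[symmetric] using lo_int g_int sandwich
    by (intro integral_mono) (auto simp: space_unif_cube simp del: One_nat_def)
  have upper: "(\<integral>w. g w \<partial>unif_cube n) \<le> upper_sum n g B"
    unfolding up_int(2)[symmetric] using up_int g_int sandwich
    by (intro integral_mono) (auto simp: space_unif_cube simp del: One_nat_def)
  have "\<forall>\<^sub>F N in sequentially. lower_sum n g B - e / 2 < (\<Sum>i<N. lo (W i)) / real N"
    using lo_lim e unfolding cesaro_lim_def by (intro order_tendstoD(1)) auto
  moreover have "\<forall>\<^sub>F N in sequentially. (\<Sum>i<N. up (W i)) / real N < upper_sum n g B + e / 2"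
    using up_lim e unfolding cesaro_lim_def by (intro order_tendstoD(2)) auto
  ultimately have "\<forall>\<^sub>F N in sequentially.
      norm ((\<Sum>i<N. g (W i)) / real N - (\<integral>w. g w \<partial>unif_cube n)) < e"
  proof eventually_elim
    case (elim N)
    have "(\<Sum>i<N. lo (W i)) / real N \<le> (\<Sum>i<N. g (W i)) / real N"
      "(\<Sum>i<N. g (W i)) / real N \<le> (\<Sum>i<N. up (W i)) / real N"
      using sandwich W by (auto intro!: divide_right_mono sum_mono)
    then show ?case using elim lower upper B(2) by (simp only: real_norm_def)
  qed
  then show "\<exists>no. \<forall>N\<ge>no. norm ((\<Sum>i<N. g (W i)) / real N - (\<integral>w. g w \<partial>unif_cube n)) < e"
    unfolding eventually_sequentially .
qed

section \<open>A box inside the coupling region\<close>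

text \<open>Jordan measurability turns the positive outer content into a positive inner content.
  Hence some finite family of boxes inside \<open>C\<close> has positive total volume, is therefore
  nonempty, and any of its members serves.\<close>

lemma coupling_region_box:
  assumes "coupling_region n \<Omega> \<phi> C"
  obtains c where "\<And>j. j \<in> {1..n} \<Longrightarrow> 0 \<le> fst c j \<and> fst c j < snd c j \<and> snd c j \<le> 1"
    "\<And>w. w \<in> open_cube n \<Longrightarrow> half_open_ind n c w \<noteq> 0 \<Longrightarrow> w \<in> C"
proof -
  have C: "C \<subseteq> open_cube n" "0 < jordan_inner n C"
    using assms unfolding coupling_region_def jordan_measurable_def jordan_measure_def by auto
  define S where "S = {\<Sum>c\<in>B. volume n c | B. box_family n B \<and> nonoverlapping n B \<and>
      (\<Union>c\<in>B. closed_box n c) \<subseteq> C}"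
  \<comment> \<open>The empty family contributes the value 0. Without an element the supremum would
    be unspecified and its positivity would say nothing about \<open>S\<close>.\<close>
  have "S \<noteq> {}"
    unfolding S_def using exI[of "\<lambda>B. box_family n B \<and> nonoverlapping n B \<and>
      (\<Union>c\<in>B. closed_box n c) \<subseteq> C" "{}"] by (auto simp: box_family_def nonoverlapping_def)
  then have "\<exists>x\<in>S. 0 < x"
    using C(2) cSup_least[of S 0] unfolding jordan_inner_def S_def[symmetric]
    by (meson not_less)
  then obtain B where B: "0 < (\<Sum>c\<in>B. volume n c)" "box_family n B" "(\<Union>c\<in>B. closed_box n c) \<subseteq> C"
    unfolding S_def by blast
  then have "B \<noteq> {}" by auto
  then obtain a b where ab: "(a, b) \<in> B" by auto
  have nd: "nondegenerate n (a, b)" and sub: "closed_box n (a, b) \<subseteq> C"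
    using B ab unfolding box_family_def by blast+
  have "a \<in> closed_box n (a, b)" "b \<in> closed_box n (a, b)"
    using nd unfolding nondegenerate_def closed_box_def by (auto simp: PiE_iff less_imp_le)
  then have *: "a \<in> open_cube n" "b \<in> open_cube n"
    using sub C(1) by blast+
  show ?thesis
  proof (rule that[of "(a, b)"])
    fix j assume "j \<in> {1..n}"
    then show "0 \<le> fst (a, b) j \<and> fst (a, b) j < snd (a, b) j \<and> snd (a, b) j \<le> 1"
      using * nd unfolding nondegenerate_def open_cube_def by (auto simp: PiE_iff less_imp_le)
  next
    fix w assume "w \<in> open_cube n" "half_open_ind n (a, b) w \<noteq> 0"
    then have "w \<in> closed_box n (a, b)"
      by (auto simp: half_open_ind_eq closed_box_def open_cube_def PiE_iff less_imp_le split: if_splits)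
    then show "w \<in> C" using sub by blast
  qed
qed

section \<open>The innovation operator\<close>

declare One_nat_def [simp del] \<comment> \<open>otherwise \<open>{1..n}\<close> is rewritten to \<open>{Suc 0..n}\<close>\<close>

lemma ensemble_measurable:
  fixes \<Omega> :: "'d::{finite,linorder} point set"
  assumes \<Psi>: "(\<lambda>(y, w). \<Psi> y w) \<in>
      leb_on \<Omega> \<Otimes>\<^sub>M unif_cube (N * CARD('d)) \<rightarrow>\<^sub>M leb_pow N \<Omega>" and D: "N * CARD('d) \<le> D"
  shows "(\<lambda>z. ensemble N \<Psi> (fst z) (snd z)) \<in> leb_on \<Omega> \<Otimes>\<^sub>M unif_cube D \<rightarrow>\<^sub>M leb_pow (N + 1) \<Omega>"
  unfolding ensemble_def
proof (rule measurable_restrict)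
  fix i assume i: "i \<in> {1..N + 1}"
  have "(\<lambda>z. (fst z, restrict (snd z) {1..N * CARD('d)}))
      \<in> leb_on \<Omega> \<Otimes>\<^sub>M unif_cube D \<rightarrow>\<^sub>M leb_on \<Omega> \<Otimes>\<^sub>M unif_cube (N * CARD('d))"
    using D by (intro measurable_Pair measurable_fst
        measurable_compose[OF measurable_snd measurable_restrict_subset]) auto
  from measurable_compose[OF this \<Psi>]
  have "(\<lambda>z. \<Psi> (fst z) (restrict (snd z) {1..N * CARD('d)}))
      \<in> leb_on \<Omega> \<Otimes>\<^sub>M unif_cube D \<rightarrow>\<^sub>M leb_pow N \<Omega>" by simp
  then have "(\<lambda>z. \<Psi> (fst z) (restrict (snd z) {1..N * CARD('d)}) i)
      \<in> leb_on \<Omega> \<Otimes>\<^sub>M unif_cube D \<rightarrow>\<^sub>M leb_on \<Omega>" if "i \<noteq> N + 1"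
    using measurable_compose[OF _ measurable_component_singleton[of i "{1..N}"]] i that by auto
  then show "(\<lambda>z. if i = N + 1 then fst z else \<Psi> (fst z) (restrict (snd z) {1..N * CARD('d)}) i)
      \<in> leb_on \<Omega> \<Otimes>\<^sub>M unif_cube D \<rightarrow>\<^sub>M leb_on \<Omega>"
    by (cases "i = N + 1") simp_all
qed

lemma omit_measurable:
  assumes "i \<in> {1..N + 1}"
  shows "(\<lambda>y. omit N i y) \<in> leb_pow (N + 1) \<Omega> \<rightarrow>\<^sub>M leb_pow N \<Omega>"
  unfolding omit_def
proof (rule measurable_restrict)
  fix k assume "k \<in> {1..N}"
  then show "(\<lambda>y. if k < i then y k else y (k + 1)) \<in> leb_pow (N + 1) \<Omega> \<rightarrow>\<^sub>M leb_on \<Omega>"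
    by (cases "k < i") (auto intro!: measurable_component_singleton)
qed

context
  fixes \<Omega> :: "'d::{finite,linorder} point set"
    and \<pi> :: "'d point \<Rightarrow> real"
    and \<kappa> :: "'d point \<Rightarrow> (nat \<Rightarrow> 'd point) \<Rightarrow> real"
    and \<Psi> :: "'d point \<Rightarrow> (nat \<Rightarrow> real) \<Rightarrow> nat \<Rightarrow> 'd point"
    and N M D :: nat
  assumes D: "D = N * CARD('d) + M"
    and \<pi>: "prob_density (leb_on \<Omega>) \<pi>"
    and \<kappa>_measurable: "(\<lambda>(y, z). \<kappa> y z) \<in> borel_measurable (leb_on \<Omega> \<Otimes>\<^sub>M leb_pow N \<Omega>)"
    and \<kappa>: "\<And>y. y \<in> \<Omega> \<Longrightarrow> prob_density (leb_pow N \<Omega>) (\<kappa> y)"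
    and \<Psi>_measurable: "(\<lambda>(y, w). \<Psi> y w) \<in>
          leb_on \<Omega> \<Otimes>\<^sub>M unif_cube (N * CARD('d)) \<rightarrow>\<^sub>M leb_pow N \<Omega>"
begin

lemma selection_weight_measurable:
  assumes i: "i \<in> {1..N + 1}"
  shows "(\<lambda>y. \<pi> (y i) * \<kappa> (y i) (omit N i y)) \<in> borel_measurable (leb_pow (N + 1) \<Omega>)"
proof -
  have yi: "(\<lambda>y. y i) \<in> leb_pow (N + 1) \<Omega> \<rightarrow>\<^sub>M leb_on \<Omega>"
    using i by (rule measurable_component_singleton)
  have "(\<lambda>y. (y i, omit N i y)) \<in> leb_pow (N + 1) \<Omega> \<rightarrow>\<^sub>M leb_on \<Omega> \<Otimes>\<^sub>M leb_pow N \<Omega>"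
    using yi omit_measurable[OF i] by (rule measurable_Pair)
  from measurable_compose[OF this \<kappa>_measurable] measurable_compose[OF yi] \<pi>
  show ?thesis unfolding prob_density_def by (intro borel_measurable_times) auto
qed

lemma cumulative_prob_measurable:
  assumes "j \<le> N + 1"
  shows "(\<lambda>y. cumulative_prob N \<pi> \<kappa> y j) \<in> borel_measurable (leb_pow (N + 1) \<Omega>)"
  unfolding cumulative_prob_def selection_prob_def
  using assms by (intro borel_measurable_sum borel_measurable_divide selection_weight_measurable) auto

lemma selection_prob_nonneg:
  assumes y: "y \<in> space (leb_pow (N + 1) \<Omega>)" and i: "i \<in> {1..N + 1}"
  shows "0 \<le> selection_prob N \<pi> \<kappa> y i"
proof -
  have "0 \<le> \<pi> (y k) * \<kappa> (y k) (omit N k y)" if "k \<in> {1..N + 1}" for k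
  proof -
    have yk: "y k \<in> \<Omega>"
      using y that by (auto simp: space_PiM space_restrict_space PiE_iff)
    have "omit N k y \<in> space (leb_pow N \<Omega>)"
      using measurable_space[OF omit_measurable[OF that] y] .
    with yk show ?thesis
      using \<pi> \<kappa>[OF yk] unfolding prob_density_def
      by (intro mult_nonneg_nonneg) (auto simp: space_restrict_space)
  qed
  then show ?thesis
    unfolding selection_prob_def using i by (intro divide_nonneg_nonneg sum_nonneg) auto
qed

text \<open>Nonnegative weights make \<open>cumulative_prob\<close> nondecreasing in the index, so
  the selection intervals are disjoint. This includes a vanishing denominator, where all weights are
  0 by the convention for division.\<close>

lemma selects_unique:
  assumes y: "y \<in> space (leb_pow (N + 1) \<Omega>)"
    and "selects N \<pi> \<kappa> y t j" "selects N \<pi> \<kappa> y t j'"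
  shows "j = j'"
proof -
  have less: False if "selects N \<pi> \<kappa> y t j" "selects N \<pi> \<kappa> y t j'" "j < j'" for j j'
  proof -
    have "cumulative_prob N \<pi> \<kappa> y j \<le> cumulative_prob N \<pi> \<kappa> y (j' - 1)"
      unfolding cumulative_prob_def using that
      by (intro sum_mono2 selection_prob_nonneg[OF y]) (auto simp: selects_def)
    then show False using that unfolding selects_def by auto
  qed
  then show ?thesis using assms(2,3) by (metis nat_neq_iff)
qed

text \<open>The sample is a component of the ensemble at a random index with finitely many values,
  so it suffices that the ensemble and the index are measurable.\<close>

lemma innovation_measurable:
  assumes m: "m \<in> {1..M}"
  shows "(\<lambda>z. innovation N M \<pi> \<kappa> \<Psi> (fst z) (snd z) m)
    \<in> leb_on \<Omega> \<Otimes>\<^sub>M unif_cube D \<rightarrow>\<^sub>M leb_on \<Omega>"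
proof -
  let ?P = "leb_on \<Omega> \<Otimes>\<^sub>M unif_cube D"
  define ens where "ens z = ensemble N \<Psi> (fst z) (snd z)" for z
  define sel where "sel z j \<longleftrightarrow> selects N \<pi> \<kappa> (ens z) (snd z (N * CARD('d) + m)) j" for z j
  \<comment> \<open>The default \<open>N + 1\<close> is the position of the carried-over point,
    which makes staying at \<open>x\<close> a choice of index as well.\<close>
  define J where "J z = (if \<exists>j. sel z j then THE j. sel z j else N + 1)" for z
  have ens: "ens \<in> ?P \<rightarrow>\<^sub>M leb_pow (N + 1) \<Omega>"
    unfolding ens_def by (rule ensemble_measurable[OF \<Psi>_measurable]) (simp add: D)
  have "(\<lambda>w. w (N * CARD('d) + m)) \<in> unif_cube D \<rightarrow>\<^sub>M leb_on {0<..<1}"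
    using m D by (intro measurable_component_singleton) auto
  moreover have "(\<lambda>t. t) \<in> borel_measurable (leb_on {0<..<1::real})"
    by (intro measurable_restrict_space1) simp
  ultimately have "(\<lambda>w. w (N * CARD('d) + m)) \<in> borel_measurable (unif_cube D)"
    by (rule measurable_compose)
  then have t: "(\<lambda>z. snd z (N * CARD('d) + m)) \<in> borel_measurable ?P"
    by (rule measurable_compose[OF measurable_snd])
  have uniq: "j = j'" if "z \<in> space ?P" "sel z j" "sel z j'" for z j j'
    using selects_unique[OF measurable_space[OF ens that(1)]] that(2,3) unfolding sel_def .
  have range: "j \<in> {1..N + 1}" if "sel z j" for z j
    using that unfolding sel_def selects_def by blast
  have sel_sets: "{z \<in> space ?P. sel z j} \<in> sets ?P" if j: "j \<in> {1..N + 1}" for j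
  proof -
    have "{z \<in> space ?P. sel z j} =
        {z \<in> space ?P. cumulative_prob N \<pi> \<kappa> (ens z) (j - 1) < snd z (N * CARD('d) + m)} \<inter>
        {z \<in> space ?P. snd z (N * CARD('d) + m) \<le> cumulative_prob N \<pi> \<kappa> (ens z) j}"
      using j unfolding sel_def selects_def by auto
    moreover have "(\<lambda>z. cumulative_prob N \<pi> \<kappa> (ens z) (j - 1)) \<in> borel_measurable ?P"
      "(\<lambda>z. cumulative_prob N \<pi> \<kappa> (ens z) j) \<in> borel_measurable ?P"
      using j by (intro measurable_compose[OF ens cumulative_prob_measurable]; auto)+
    ultimately show ?thesis
      using t by (auto intro!: sets.Int borel_measurable_less borel_measurable_le)
  qed
  have J_eq: "J z = j" if "z \<in> space ?P" "sel z j" for z j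
    unfolding J_def using that uniq[OF that(1)] by (auto intro!: the_equality)
  have J_range: "J z \<in> {1..N + 1}" if "z \<in> space ?P" for z
  proof (cases "\<exists>j. sel z j")
    case True
    then show ?thesis using J_eq[OF that] range by metis
  qed (simp add: J_def)
  have J: "J \<in> ?P \<rightarrow>\<^sub>M count_space {1..N + 1}"
  proof (subst measurable_count_space_eq2, simp, intro conjI ballI)
    show "J \<in> space ?P \<rightarrow> {1..N + 1}" using J_range by blast
    fix a assume a: "a \<in> {1..N + 1}"
    have "J -` {a} \<inter> space ?P = {z \<in> space ?P. sel z a} \<union>
        (if a = N + 1 then space ?P - (\<Union>j\<in>{1..N + 1}. {z \<in> space ?P. sel z j}) else {})"
    proof (intro set_eqI)
      fix z
      show "z \<in> J -` {a} \<inter> space ?P \<longleftrightarrow> z \<in> {z \<in> space ?P. sel z a} \<union>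
        (if a = N + 1 then space ?P - (\<Union>j\<in>{1..N + 1}. {z \<in> space ?P. sel z j}) else {})"
      proof (cases "z \<in> space ?P \<and> (\<exists>j. sel z j)")
        case True
        then obtain j where "z \<in> space ?P" "sel z j" "j \<in> {1..N + 1}" using range by blast
        then show ?thesis using J_eq[of z j] uniq[of z j a] by auto
      next
        case False
        then show ?thesis unfolding J_def by auto
      qed
    qed
    also have "\<dots> \<in> sets ?P"
      using sel_sets a by auto
    finally show "J -` {a} \<inter> space ?P \<in> sets ?P" .
  qed
  have "(\<lambda>z. ens z (J z)) \<in> ?P \<rightarrow>\<^sub>M leb_on \<Omega>"
    by (rule measurable_compose_countable'[OF _ J])
      (auto intro!: measurable_compose[OF ens measurable_component_singleton])
  moreover have "innovation N M \<pi> \<kappa> \<Psi> (fst z) (snd z) m = ens z (J z)" for z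
  proof -
    have "innovation N M \<pi> \<kappa> \<Psi> (fst z) (snd z) m
        = (if \<exists>j. sel z j then ens z (THE j. sel z j) else fst z)"
      unfolding innovation_def Let_def sel_def ens_def using m by (simp only: restrict_apply if_True)
    moreover have "ens z (N + 1) = fst z"
      unfolding ens_def ensemble_def by simp
    ultimately show ?thesis unfolding J_def by (simp only: if_distrib)
  qed
  ultimately show ?thesis by simp
qed

section \<open>All samples of one iteration have the same one-step law\<close>

text \<open>The proposals depend on the first \<open>N * CARD('d)\<close> coordinates only, and the
  transposition \<open>\<sigma>\<close> fixes these. It exchanges just the two coordinates that
  select the samples \<open>m\<close> and \<open>M\<close>.\<close>

lemma innovation_swap:
  assumes "m \<in> {1..M}"
  defines "\<sigma> \<equiv> id(N * CARD('d) + m := N * CARD('d) + M, N * CARD('d) + M := N * CARD('d) + m)"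
  shows "innovation N M \<pi> \<kappa> \<Psi> y (\<lambda>l\<in>{1..D}. u (\<sigma> l)) M = innovation N M \<pi> \<kappa> \<Psi> y u m"
proof -
  have "restrict (\<lambda>l\<in>{1..D}. u (\<sigma> l)) {1..N * CARD('d)} = restrict u {1..N * CARD('d)}"
    using assms by (auto simp: restrict_def D \<sigma>_def)
  then have ens: "ensemble N \<Psi> y (\<lambda>l\<in>{1..D}. u (\<sigma> l)) = ensemble N \<Psi> y u"
    unfolding ensemble_def by (simp only:)
  have t: "(\<lambda>l\<in>{1..D}. u (\<sigma> l)) (N * CARD('d) + M) = u (N * CARD('d) + m)"
    using assms by (auto simp: D \<sigma>_def)
  have M: "M \<in> {1..M}" using assms by simp
  show ?thesis
    unfolding innovation_def Let_def restrict_apply'[OF M] restrict_apply'[OF assms(1)] ens t ..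
qed

text \<open>The uniform distribution on the cube is invariant under permutations of coordinates.
  This carries the invariance of \<open>\<pi>\<close>, known for the last sample, over to every
  sample of an iteration.\<close>

lemma integral_innovation_eq:
  fixes F :: "'d point \<Rightarrow> real"
  assumes m: "m \<in> {1..M}" and y: "y \<in> \<Omega>" and F: "F \<in> borel_measurable (leb_on \<Omega>)"
  shows "(\<integral>u. F (innovation N M \<pi> \<kappa> \<Psi> y u m) \<partial>unif_cube D)
    = (\<integral>u. F (innovation N M \<pi> \<kappa> \<Psi> y u M) \<partial>unif_cube D)"
proof -
  define \<sigma> where "\<sigma> = id(N * CARD('d) + m := N * CARD('d) + M, N * CARD('d) + M := N * CARD('d) + m)"
  have \<sigma>: "inj_on \<sigma> {1..D}" "\<sigma> \<in> {1..D} \<rightarrow> {1..D}"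
    using m unfolding \<sigma>_def D by (auto simp: inj_on_def split: if_splits)
  have meas: "(\<lambda>u. F (innovation N M \<pi> \<kappa> \<Psi> y u M)) \<in> borel_measurable (unif_cube D)"
    using m y measurable_compose[OF measurable_Pair1' innovation_measurable[of M], of y]
    by (intro measurable_compose[OF _ F]) (auto simp: space_restrict_space)
  have T: "(\<lambda>u. \<lambda>l\<in>{1..D}. u (\<sigma> l)) \<in> unif_cube D \<rightarrow>\<^sub>M unif_cube D"
    using \<sigma>(2) by (intro measurable_restrict measurable_component_singleton) auto
  have "(\<integral>u. F (innovation N M \<pi> \<kappa> \<Psi> y u M) \<partial>unif_cube D)
      = (\<integral>u. F (innovation N M \<pi> \<kappa> \<Psi> y u M) \<partial>distr (unif_cube D) (unif_cube D) (\<lambda>u. \<lambda>l\<in>{1..D}. u (\<sigma> l)))"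
    using distr_PiM_reindex[of "{1..D}" "\<lambda>_. leb_on {0<..<1::real}" \<sigma> "{1..D}"] \<sigma> prob_space_unif
    by simp
  also have "\<dots> = (\<integral>u. F (innovation N M \<pi> \<kappa> \<Psi> y u m) \<partial>unif_cube D)"
    using T meas innovation_swap[OF m] by (subst integral_distr) (auto simp: \<sigma>_def)
  finally show ?thesis by simp
qed

end

section \<open>Transition operators of random maps\<close>

definition transition_op ::
  "'u measure \<Rightarrow> ('a \<Rightarrow> 'u \<Rightarrow> 'a) \<Rightarrow> ('a \<Rightarrow> real) \<Rightarrow> 'a \<Rightarrow> real" where
  "transition_op R h F y = (\<integral>u. F (h y u) \<partial>R)"

locale random_map = prob_space R for R :: "'u measure" +
  fixes S :: "'a measure" and h :: "'a \<Rightarrow> 'u \<Rightarrow> 'a"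
  assumes h: "(\<lambda>z. h (fst z) (snd z)) \<in> S \<Otimes>\<^sub>M R \<rightarrow>\<^sub>M S"
begin

lemma h_section: "y \<in> space S \<Longrightarrow> h y \<in> R \<rightarrow>\<^sub>M S"
  using measurable_compose[OF measurable_Pair1' h, of y] by simp

lemma integrable_section:
  fixes F :: "'a \<Rightarrow> real"
  assumes "F \<in> borel_measurable S" "\<And>y. y \<in> space S \<Longrightarrow> \<bar>F y\<bar> \<le> B" "y \<in> space S"
  shows "integrable R (\<lambda>u. F (h y u))"
proof (rule integrable_const_bound[of _ B])
  show "AE u in R. norm (F (h y u)) \<le> B"
    using assms(2) measurable_space[OF h_section[OF assms(3)]] by (intro AE_I2) simp
  show "(\<lambda>u. F (h y u)) \<in> borel_measurable R"
    using h_section[OF assms(3)] assms(1) by (rule measurable_compose)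
qed

lemma transition_op_measurable:
  assumes "F \<in> borel_measurable S"
  shows "transition_op R h F \<in> borel_measurable S"
proof -
  have "(\<lambda>(y, u). F (h y u)) \<in> borel_measurable (S \<Otimes>\<^sub>M R)"
    using measurable_compose[OF h assms] by (simp add: split_beta)
  then show ?thesis
    unfolding transition_op_def[abs_def] by (rule borel_measurable_lebesgue_integral)
qed

lemma transition_op_bounded:
  assumes "F \<in> borel_measurable S" "\<And>y. y \<in> space S \<Longrightarrow> \<bar>F y\<bar> \<le> B" "y \<in> space S"
  shows "\<bar>transition_op R h F y\<bar> \<le> B"
proof -
  have "\<bar>transition_op R h F y\<bar> \<le> (\<integral>u. \<bar>F (h y u)\<bar> \<partial>R)"
    unfolding transition_op_def by (rule integral_abs_bound)
  also have "\<dots> \<le> (\<integral>u. B \<partial>R)"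
    using assms measurable_space[OF h_section[OF assms(3)]]
    by (intro integral_mono integrable_abs integrable_section[of F B]) auto
  finally show ?thesis by (simp add: prob_space)
qed

text \<open>Invariance on sets says that \<open>h\<close> maps the product of \<open>\<mu>\<close>
  and \<open>R\<close> to \<open>\<mu>\<close>. The claim for functions follows by change of
  variables and Fubini.\<close>

lemma integral_transition_op:
  assumes inv: "invariant_distribution S R h \<mu>"
    and F: "F \<in> borel_measurable S" "\<And>y. y \<in> space S \<Longrightarrow> \<bar>F y\<bar> \<le> B"
  shows "(\<integral>y. transition_op R h F y \<partial>\<mu>) = (\<integral>y. F y \<partial>\<mu>)"
proof -
  interpret \<mu>: prob_space \<mu>
    using inv unfolding invariant_distribution_def by blast
  interpret Q: pair_prob_space \<mu> R ..
  have sets: "sets \<mu> = sets S" and sp: "space \<mu> = space S"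
    using inv unfolding invariant_distribution_def by (auto dest: sets_eq_imp_space_eq)
  have h': "(\<lambda>z. h (fst z) (snd z)) \<in> \<mu> \<Otimes>\<^sub>M R \<rightarrow>\<^sub>M S"
    using h sets by (simp cong: measurable_cong_sets sets_pair_measure_cong)
  have "distr (\<mu> \<Otimes>\<^sub>M R) S (\<lambda>z. h (fst z) (snd z)) = \<mu>"
  proof (rule measure_eqI)
    fix A assume "A \<in> sets (distr (\<mu> \<Otimes>\<^sub>M R) S (\<lambda>z. h (fst z) (snd z)))"
    then have A: "A \<in> sets S" by simp
    have "emeasure (distr (\<mu> \<Otimes>\<^sub>M R) S (\<lambda>z. h (fst z) (snd z))) A
        = emeasure (\<mu> \<Otimes>\<^sub>M R) ((\<lambda>z. h (fst z) (snd z)) -` A \<inter> space (\<mu> \<Otimes>\<^sub>M R))"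
      by (rule emeasure_distr[OF h' A])
    also have "\<dots> = (\<integral>\<^sup>+y. emeasure R (Pair y -` ((\<lambda>z. h (fst z) (snd z)) -` A \<inter> space (\<mu> \<Otimes>\<^sub>M R))) \<partial>\<mu>)"
      by (rule emeasure_pair_measure_alt[OF measurable_sets[OF h' A]])
    also have "\<dots> = (\<integral>\<^sup>+y. emeasure R {u \<in> space R. h y u \<in> A} \<partial>\<mu>)"
      by (intro nn_integral_cong arg_cong[where f = "emeasure R"]) (auto simp: space_pair_measure)
    also have "\<dots> = emeasure \<mu> A"
      using inv A unfolding invariant_distribution_def by blast
    finally show "emeasure (distr (\<mu> \<Otimes>\<^sub>M R) S (\<lambda>z. h (fst z) (snd z))) A = emeasure \<mu> A" .
  qed (simp add: sets)
  then have "(\<integral>y. F y \<partial>\<mu>) = (\<integral>y. F y \<partial>distr (\<mu> \<Otimes>\<^sub>M R) S (\<lambda>z. h (fst z) (snd z)))"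
    by simp
  also have "\<dots> = (\<integral>z. F (h (fst z) (snd z)) \<partial>(\<mu> \<Otimes>\<^sub>M R))"
    by (rule integral_distr[OF h' F(1)])
  also have "\<dots> = (\<integral>y. \<integral>u. F (h y u) \<partial>R \<partial>\<mu>)"
  proof -
    have "integrable (\<mu> \<Otimes>\<^sub>M R) (\<lambda>z. F (h (fst z) (snd z)))"
    proof (rule Q.P.integrable_const_bound[of _ B])
      show "AE z in \<mu> \<Otimes>\<^sub>M R. norm (F (h (fst z) (snd z))) \<le> B"
        using F(2) measurable_space[OF h'] by (intro AE_I2) simp
      show "(\<lambda>z. F (h (fst z) (snd z))) \<in> borel_measurable (\<mu> \<Otimes>\<^sub>M R)"
        using h' F(1) by (rule measurable_compose)
    qed
    from Q.integral_fst'[OF this] show ?thesis by simp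
  qed
  finally show ?thesis unfolding transition_op_def by simp
qed

text \<open>On \<open>G\<close> the two chains coalesce, so only the complement of \<open>G\<close> contributes.\<close>

lemma transition_op_contraction:
  assumes F: "F \<in> borel_measurable S" "\<And>y. y \<in> space S \<Longrightarrow> \<bar>F y\<bar> \<le> B"
    and osc: "\<And>y y'. y \<in> space S \<Longrightarrow> y' \<in> space S \<Longrightarrow> \<bar>F y - F y'\<bar> \<le> K"
    and G: "integrable R G" "(\<integral>u. G u \<partial>R) = c"
    and G01: "\<And>u. u \<in> space R \<Longrightarrow> G u = 0 \<or>
        G u = 1 \<and> (\<forall>y\<in>space S. \<forall>y'\<in>space S. h y u = h y' u)"
    and y: "y \<in> space S" "y' \<in> space S"
  shows "\<bar>transition_op R h F y - transition_op R h F y'\<bar> \<le> (1 - c) * K"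
proof -
  note int = integrable_section[OF F y(1)] integrable_section[OF F y(2)]
  have pt: "\<bar>F (h y u) - F (h y' u)\<bar> \<le> (1 - G u) * K" if u: "u \<in> space R" for u
    using G01[OF u]
  proof
    assume "G u = 0"
    then show ?thesis
      using osc measurable_space[OF h_section u] y by simp
  next
    assume "G u = 1 \<and> (\<forall>y\<in>space S. \<forall>y'\<in>space S. h y u = h y' u)"
    then have "G u = 1" "h y u = h y' u" using y by blast+
    then show ?thesis by simp
  qed
  have "\<bar>transition_op R h F y - transition_op R h F y'\<bar> = \<bar>\<integral>u. F (h y u) - F (h y' u) \<partial>R\<bar>"
    unfolding transition_op_def using int by simp
  also have "\<dots> \<le> (\<integral>u. \<bar>F (h y u) - F (h y' u)\<bar> \<partial>R)"
    by (rule integral_abs_bound)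
  also have "\<dots> \<le> (\<integral>u. (1 - G u) * K \<partial>R)"
    using int G(1) pt by (intro integral_mono) auto
  also have "\<dots> = (1 - c) * K"
    using G by (simp add: prob_space)
  finally show ?thesis .
qed

text \<open>Each application preserves the \<open>\<mu>\<close>-mean and shrinks the oscillation by
  \<open>1 - c\<close>, starting from at most \<open>2 * B\<close>. A function differs from its mean
  by no more than its oscillation.\<close>

lemma transition_op_iterates:
  assumes inv: "invariant_distribution S R h \<mu>"
    and F: "F \<in> borel_measurable S" "\<And>y. y \<in> space S \<Longrightarrow> \<bar>F y\<bar> \<le> B"
    and G: "integrable R G" "(\<integral>u. G u \<partial>R) = c"
    and G01: "\<And>u. u \<in> space R \<Longrightarrow> G u = 0 \<or>
        G u = 1 \<and> (\<forall>y\<in>space S. \<forall>y'\<in>space S. h y u = h y' u)"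
    and x: "x \<in> space S"
  shows "\<bar>(transition_op R h ^^ m) F x - (\<integral>y. F y \<partial>\<mu>)\<bar> \<le> (1 - c) ^ m * (2 * B)"
proof -
  interpret \<mu>: prob_space \<mu>
    using inv unfolding invariant_distribution_def by blast
  have sets: "sets \<mu> = sets S" and sp: "space \<mu> = space S"
    using inv unfolding invariant_distribution_def by (auto dest: sets_eq_imp_space_eq)
  let ?T = "(transition_op R h ^^ m) F"
  \<comment> \<open>Measurability and the bound \<open>B\<close> join the induction because
    contraction and preservation of the mean require them of every iterate.\<close>
  have "?T \<in> borel_measurable S \<and> (\<forall>y\<in>space S. \<bar>?T y\<bar> \<le> B) \<and> (\<integral>y. ?T y \<partial>\<mu>) = (\<integral>y. F y \<partial>\<mu>)
      \<and> (\<forall>y\<in>space S. \<forall>y'\<in>space S. \<bar>?T y - ?T y'\<bar> \<le> (1 - c) ^ m * (2 * B))"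
  proof (induction m)
    case 0
    have "\<bar>F y - F y'\<bar> \<le> 2 * B" if "y \<in> space S" "y' \<in> space S" for y y'
      using F(2)[OF that(1)] F(2)[OF that(2)] by linarith
    then show ?case using F by simp
  next
    case (Suc m)
    let ?T = "(transition_op R h ^^ m) F"
    have T: "?T \<in> borel_measurable S" "\<And>y. y \<in> space S \<Longrightarrow> \<bar>?T y\<bar> \<le> B"
      using Suc by blast+
    have "\<bar>transition_op R h ?T y - transition_op R h ?T y'\<bar> \<le> (1 - c) ^ Suc m * (2 * B)"
      if "y \<in> space S" "y' \<in> space S" for y y'
    proof -
      have "\<bar>transition_op R h ?T y - transition_op R h ?T y'\<bar> \<le> (1 - c) * ((1 - c) ^ m * (2 * B))"
        using Suc that by (intro transition_op_contraction[OF T _ G G01]) auto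
      then show ?thesis by (simp add: mult.assoc)
    qed
    then show ?case
      using transition_op_measurable[OF T(1)] transition_op_bounded[OF T]
        integral_transition_op[OF inv T] Suc by simp
  qed
  then have T: "?T \<in> borel_measurable \<mu>" "\<And>y. y \<in> space \<mu> \<Longrightarrow> \<bar>?T y\<bar> \<le> B"
    "(\<integral>y. ?T y \<partial>\<mu>) = (\<integral>y. F y \<partial>\<mu>)"
    "\<And>y. y \<in> space \<mu> \<Longrightarrow> \<bar>?T x - ?T y\<bar> \<le> (1 - c) ^ m * (2 * B)"
    using x by (auto simp: sp cong: measurable_cong_sets[OF sets refl])
  have int: "integrable \<mu> ?T"
    using T(2) by (intro \<mu>.integrable_const_bound[of _ B] T(1) AE_I2) simp
  have "\<bar>?T x - (\<integral>y. F y \<partial>\<mu>)\<bar> = \<bar>\<integral>y. ?T x - ?T y \<partial>\<mu>\<bar>"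
    using int by (simp add: T(3) \<mu>.prob_space)
  also have "\<dots> \<le> (\<integral>y. \<bar>?T x - ?T y\<bar> \<partial>\<mu>)"
    by (rule integral_abs_bound)
  also have "\<dots> \<le> (\<integral>y. (1 - c) ^ m * (2 * B) \<partial>\<mu>)"
    using int T(4) by (intro integral_mono) auto
  finally show ?thesis by (simp add: \<mu>.prob_space)
qed

end

section \<open>Long driving vectors as sequences of blocks\<close>

text \<open>Blocks are counted from 1, like the iterations, in the form in which
  \<open>regular\<close> feeds a vector of length \<open>i * D\<close> to the sampler.\<close>

definition block :: "nat \<Rightarrow> (nat \<Rightarrow> real) \<Rightarrow> nat \<Rightarrow> nat \<Rightarrow> real" where
  "block D w k = (\<lambda>l\<in>{1..D}. w ((k - 1) * D + l))"

lemma recursion_cong: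
  assumes "\<And>i. 1 \<le> i \<Longrightarrow> i \<le> m \<Longrightarrow> U i = V i"
  shows "recursion h x U m = recursion h x V m"
  using assms by (induction m) auto

lemma block_index_le:
  fixes k m l D :: nat
  assumes "1 \<le> k" "k \<le> m" "l \<in> {1..D}"
  shows "(k - 1) * D + l \<in> {1..m * D}"
proof -
  have "(k - 1) * D + D = k * D" using assms(1) by (cases k) auto
  then have "(k - 1) * D + D \<le> m * D" using assms(2) by simp
  then show ?thesis using assms(3) by auto
qed

lemma block_measurable:
  assumes "1 \<le> k" "k \<le> m"
  shows "(\<lambda>w. block D w k) \<in> unif_cube (m * D) \<rightarrow>\<^sub>M unif_cube D"
  unfolding block_def
  by (intro measurable_restrict measurable_component_singleton block_index_le[OF assms])

definition append_block :: "nat \<Rightarrow> nat \<Rightarrow> (nat \<Rightarrow> real) \<times> (nat \<Rightarrow> real) \<Rightarrow> nat \<Rightarrow> real" where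
  "append_block n D z = (\<lambda>i\<in>{1..n + D}. if i \<le> n then fst z i else snd z (i - n))"

lemma append_block_measurable:
  "append_block n D \<in> unif_cube n \<Otimes>\<^sub>M unif_cube D \<rightarrow>\<^sub>M unif_cube (n + D)"
  unfolding append_block_def[abs_def]
proof (rule measurable_restrict)
  fix i assume i: "i \<in> {1..n + D}"
  show "(\<lambda>z. if i \<le> n then fst z i else snd z (i - n))
      \<in> unif_cube n \<Otimes>\<^sub>M unif_cube D \<rightarrow>\<^sub>M leb_on {0<..<1}"
  proof (cases "i \<le> n")
    case True
    then have "(\<lambda>w. w i) \<in> unif_cube n \<rightarrow>\<^sub>M leb_on {0<..<1}"
      using i by (intro measurable_component_singleton) auto
    then show ?thesis using True by (simp add: measurable_compose[OF measurable_fst])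
  next
    case False
    then have "(\<lambda>w. w (i - n)) \<in> unif_cube D \<rightarrow>\<^sub>M leb_on {0<..<1}"
      using i by (intro measurable_component_singleton) auto
    then show ?thesis using False by (simp add: measurable_compose[OF measurable_snd])
  qed
qed

text \<open>Product measures are determined by their values on boxes, and the preimage of a box
  under concatenation is a product of two boxes. This identifies the cube of dimension
  \<open>n + D\<close> with a product of cubes, so that Fubini can separate the last block.\<close>

lemma distr_append_block:
  "distr (unif_cube n \<Otimes>\<^sub>M unif_cube D) (unif_cube (n + D)) (append_block n D) = unif_cube (n + D)"
proof -
  interpret product_prob_space "\<lambda>_::nat. leb_on {0<..<1::real}" "{1..n + D}"
    by (rule product_prob_spaceI) (rule prob_space_unif)
  interpret D: prob_space "unif_cube D" by (rule prob_space_unif_cube)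
  show ?thesis
  proof (rule PiM_eqI)
    fix A :: "nat \<Rightarrow> real set" assume A: "\<And>i. i \<in> {1..n + D} \<Longrightarrow> A i \<in> sets (leb_on {0<..<1})"
    have A1: "A i \<in> sets (leb_on {0<..<1})" if "i \<in> {1..n}" for i
      using that by (intro A) auto
    have A2: "A (n + i) \<in> sets (leb_on {0<..<1})" if "i \<in> {1..D}" for i
      using that by (intro A) auto
    have "append_block n D -` PiE {1..n + D} A \<inter> space (unif_cube n \<Otimes>\<^sub>M unif_cube D)
        = PiE {1..n} A \<times> PiE {1..D} (\<lambda>i. A (n + i))" (is "?L = ?R")
    proof (intro set_eqI iffI)
      fix z assume z: "z \<in> ?L"
      then have sp: "fst z \<in> extensional {1..n}" "snd z \<in> extensional {1..D}"
        by (auto simp: space_pair_measure space_PiM PiE_iff)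
      have mem: "append_block n D z i \<in> A i" if "i \<in> {1..n + D}" for i
        using z that by (auto simp: PiE_iff)
      have "fst z i \<in> A i" if "i \<in> {1..n}" for i
        using mem[of i] that by (simp add: append_block_def)
      moreover have "snd z i \<in> A (n + i)" if "i \<in> {1..D}" for i
        using mem[of "n + i"] that by (simp add: append_block_def)
      ultimately show "z \<in> ?R" using sp by (auto simp: mem_Times_iff PiE_iff)
    next
      fix z assume z: "z \<in> ?R"
      have "PiE {1..n} A \<subseteq> space (unif_cube n)" "PiE {1..D} (\<lambda>i. A (n + i)) \<subseteq> space (unif_cube D)"
        using A1[THEN sets.sets_into_space] A2[THEN sets.sets_into_space]
        unfolding space_PiM by (intro PiE_mono; blast)+
      then have "z \<in> space (unif_cube n \<Otimes>\<^sub>M unif_cube D)"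
        using z by (auto simp: space_pair_measure mem_Times_iff)
      moreover have "append_block n D z i \<in> A i" if i: "i \<in> {1..n + D}" for i
      proof (cases "i \<le> n")
        case True
        then have "fst z i \<in> A i" using z i by (auto simp: mem_Times_iff PiE_iff)
        then show ?thesis using True i by (simp add: append_block_def)
      next
        case False
        then have "i - n \<in> {1..D}" using i by auto
        then have "snd z (i - n) \<in> A (n + (i - n))"
          using z unfolding mem_Times_iff PiE_iff by blast
        then show ?thesis using False i by (simp add: append_block_def)
      qed
      ultimately show "z \<in> ?L" by (auto simp: PiE_iff append_block_def)
    qed
    then have "emeasure (distr (unif_cube n \<Otimes>\<^sub>M unif_cube D) (unif_cube (n + D)) (append_block n D)) (PiE {1..n + D} A)
        = emeasure (unif_cube n \<Otimes>\<^sub>M unif_cube D) (PiE {1..n} A \<times> PiE {1..D} (\<lambda>i. A (n + i)))"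
      using A by (subst emeasure_distr[OF append_block_measurable]) (auto intro!: sets_PiM_I_finite)
    also have "\<dots> = emeasure (unif_cube n) (PiE {1..n} A) * emeasure (unif_cube D) (PiE {1..D} (\<lambda>i. A (n + i)))"
      using A1 A2 by (intro D.emeasure_pair_measure_Times sets_PiM_I_finite) auto
    also have "\<dots> = (\<Prod>i=1..n. emeasure (leb_on {0<..<1}) (A i)) * (\<Prod>i=1..D. emeasure (leb_on {0<..<1}) (A (n + i)))"
      using A1 A2 by (intro arg_cong2[where f = "(*)"] emeasure_PiM) auto
    also have "(\<Prod>i=1..D. emeasure (leb_on {0<..<1}) (A (n + i))) = (\<Prod>i=n+1..n+D. emeasure (leb_on {0<..<1}) (A i))"
      using prod.shift_bounds_cl_nat_ivl[of "\<lambda>i. emeasure (leb_on {0<..<1}) (A i)" 1 n D]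
      by (simp add: add.commute)
    also have "(\<Prod>i=1..n. emeasure (leb_on {0<..<1}) (A i)) * \<dots> = (\<Prod>i=1..n+D. emeasure (leb_on {0<..<1}) (A i))"
      using prod.ub_add_nat[of 1 n "\<lambda>i. emeasure (leb_on {0<..<1}) (A i)" D] by simp
    finally show "emeasure (distr (unif_cube n \<Otimes>\<^sub>M unif_cube D) (unif_cube (n + D)) (append_block n D)) (PiE {1..n + D} A)
        = (\<Prod>i=1..n+D. emeasure (leb_on {0<..<1}) (A i))" .
  qed simp_all
qed

lemma block_append_block:
  assumes "1 \<le> k" "k \<le> m"
  shows "block D (append_block (m * D) D z) k = block D (fst z) k"
  unfolding block_def append_block_def
proof (intro restrict_ext)
  fix l assume "l \<in> {1..D}"
  then have "(k - 1) * D + l \<in> {1..m * D}" by (rule block_index_le[OF assms])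
  then show "(\<lambda>i\<in>{1..m * D + D}. if i \<le> m * D then fst z i else snd z (i - m * D)) ((k - 1) * D + l)
      = fst z ((k - 1) * D + l)" by simp
qed

lemma block_append_block_last:
  assumes "snd z \<in> space (unif_cube D)"
  shows "block D (append_block (m * D) D z) (Suc m) = snd z"
proof
  fix l show "block D (append_block (m * D) D z) (Suc m) l = snd z l"
    using assms by (cases "l \<in> {1..D}")
      (auto simp: block_def append_block_def space_PiM PiE_iff extensional_def)
qed

locale cube_random_map = random_map "unif_cube D" S h for D :: nat and S :: "'a measure" and h
begin

lemma recursion_measurable:
  assumes x: "x \<in> space S"
  shows "m \<le> m' \<Longrightarrow> (\<lambda>w. recursion h x (block D w) m) \<in> unif_cube (m' * D) \<rightarrow>\<^sub>M S"
proof (induction m)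
  case 0
  then show ?case using x by simp
next
  case (Suc m)
  then have "(\<lambda>w. (recursion h x (block D w) m, block D w (Suc m)))
      \<in> unif_cube (m' * D) \<rightarrow>\<^sub>M S \<Otimes>\<^sub>M unif_cube D"
    by (intro measurable_Pair block_measurable) auto
  from measurable_compose[OF this h] show ?case by simp
qed

text \<open>The first \<open>m\<close> blocks fix the state before the last step, and the last block
  is independent of them. The map \<open>\<phi>\<close> of the last step may differ from
  \<open>h\<close>, because the final iteration is read at an arbitrary sample index while the
  earlier ones pass on their last sample.\<close>

lemma integral_last_block:
  assumes x: "x \<in> space S"
    and \<phi>: "(\<lambda>z. \<phi> (fst z) (snd z)) \<in> S \<Otimes>\<^sub>M unif_cube D \<rightarrow>\<^sub>M S"
    and F: "F \<in> borel_measurable S" "\<And>y. y \<in> space S \<Longrightarrow> \<bar>F y\<bar> \<le> (B :: real)"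
  shows "(\<integral>w. F (\<phi> (recursion h x (block D w) m) (block D w (Suc m))) \<partial>unif_cube (Suc m * D))
    = (\<integral>w. (\<integral>u. F (\<phi> (recursion h x (block D w) m) u) \<partial>unif_cube D) \<partial>unif_cube (m * D))"
proof -
  interpret W: prob_space "unif_cube (m * D)" by (rule prob_space_unif_cube)
  interpret Q: pair_prob_space "unif_cube (m * D)" "unif_cube D" ..
  let ?P = "unif_cube (m * D) \<Otimes>\<^sub>M unif_cube D"
  define q where "q w = F (\<phi> (recursion h x (block D w) m) (block D w (Suc m)))" for w
  define r where "r z = F (\<phi> (recursion h x (block D (fst z)) m) (snd z))" for z
  have "(\<lambda>w. (recursion h x (block D w) m, block D w (Suc m)))
      \<in> unif_cube (Suc m * D) \<rightarrow>\<^sub>M S \<Otimes>\<^sub>M unif_cube D"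
    by (intro measurable_Pair block_measurable recursion_measurable x) auto
  from measurable_compose[OF measurable_compose[OF this \<phi>] F(1)]
  have q: "q \<in> borel_measurable (unif_cube (m * D + D))"
    unfolding q_def by (simp add: add.commute)
  have "(\<lambda>z. (recursion h x (block D (fst z)) m, snd z)) \<in> ?P \<rightarrow>\<^sub>M S \<Otimes>\<^sub>M unif_cube D"
    by (intro measurable_Pair measurable_snd measurable_compose[OF measurable_fst recursion_measurable[OF x order_refl]])
  from measurable_compose[OF this \<phi>]
  have S: "(\<lambda>z. \<phi> (recursion h x (block D (fst z)) m) (snd z)) \<in> ?P \<rightarrow>\<^sub>M S" by simp
  have "integrable ?P r"
  proof (rule Q.P.integrable_const_bound[of _ B])
    show "AE z in ?P. norm (r z) \<le> B"
      unfolding r_def real_norm_def by (intro AE_I2 F(2)) (rule measurable_space[OF S])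
    show "r \<in> borel_measurable ?P"
      unfolding r_def using S F(1) by (rule measurable_compose)
  qed
  note fubini = Q.integral_fst'[OF this]
  have qr: "q (append_block (m * D) D z) = r z" if "z \<in> space ?P" for z
  proof -
    have "recursion h x (block D (append_block (m * D) D z)) m = recursion h x (block D (fst z)) m"
      by (intro recursion_cong block_append_block)
    moreover have "block D (append_block (m * D) D z) (Suc m) = snd z"
      using that by (intro block_append_block_last) (auto simp: space_pair_measure)
    ultimately show ?thesis unfolding q_def r_def by (simp only:)
  qed
  have "(\<integral>w. q w \<partial>unif_cube (m * D + D))
      = (\<integral>w. q w \<partial>distr ?P (unif_cube (m * D + D)) (append_block (m * D) D))"
    by (simp only: distr_append_block)
  also have "\<dots> = (\<integral>z. q (append_block (m * D) D z) \<partial>?P)"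
    by (rule integral_distr[OF append_block_measurable q])
  also have "\<dots> = (\<integral>z. r z \<partial>?P)"
    using qr by (rule Bochner_Integration.integral_cong[OF refl])
  finally have "(\<integral>w. q w \<partial>unif_cube (Suc m * D)) = (\<integral>z. r z \<partial>?P)"
    by (simp add: add.commute)
  then show ?thesis
    unfolding fubini[symmetric] unfolding q_def r_def by simp
qed

text \<open>Integrating out the last block replaces \<open>F\<close> by its image under the
  transition operator; hence the induction over arbitrary \<open>F\<close> and the unfolding of the
  power on the right.\<close>

lemma integral_recursion:
  assumes x: "x \<in> space S"
    and F: "F \<in> borel_measurable S" "\<And>y. y \<in> space S \<Longrightarrow> \<bar>F y\<bar> \<le> B"
  shows "(\<integral>w. F (recursion h x (block D w) m) \<partial>unif_cube (m * D)) = (transition_op (unif_cube D) h ^^ m) F x"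
  using F
proof (induction m arbitrary: F)
  case 0
  interpret W: prob_space "unif_cube 0" by (rule prob_space_unif_cube)
  show ?case using W.prob_space by simp
next
  case (Suc m)
  have "(\<integral>w. F (recursion h x (block D w) (Suc m)) \<partial>unif_cube (Suc m * D))
      = (\<integral>w. transition_op (unif_cube D) h F (recursion h x (block D w) m) \<partial>unif_cube (m * D))"
    unfolding transition_op_def using integral_last_block[OF x h Suc.prems] by simp
  also have "\<dots> = (transition_op (unif_cube D) h ^^ m) (transition_op (unif_cube D) h F) x"
    using Suc.prems by (intro Suc.IH transition_op_measurable transition_op_bounded)
  also have "\<dots> = (transition_op (unif_cube D) h ^^ Suc m) F x"
    by (simp only: funpow_Suc_right comp_def)
  finally show ?case .
qed

end

section \<open>Coupling\<close>

lemma recursion_shift: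
  "recursion h x U (i + k) = recursion h (recursion h x U i) (\<lambda>k. U (i + k)) k"
  by (induction k) auto

text \<open>Keeps of the algorithm only what the limit argument uses: one-step laws that agree for
  all \<open>M\<close> outputs, an invariant distribution, and a nondegenerate box of driving
  vectors on which the outputs forget the state.\<close>

locale coupled_sampler =
  fixes D M :: nat and S :: "'a measure" and \<phi> :: "'a \<Rightarrow> (nat \<Rightarrow> real) \<Rightarrow> nat \<Rightarrow> 'a"
    and \<mu> :: "'a measure" and c :: corners and x0 :: 'a
  assumes D: "D \<ge> 1" and M: "M \<ge> 1"
    and \<phi>: "\<And>m. m \<in> {1..M} \<Longrightarrow> (\<lambda>z. \<phi> (fst z) (snd z) m) \<in> S \<Otimes>\<^sub>M unif_cube D \<rightarrow>\<^sub>M S"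
    and exchangeable: "\<And>m y F. m \<in> {1..M} \<Longrightarrow> y \<in> space S \<Longrightarrow> F \<in> borel_measurable S \<Longrightarrow>
      (\<integral>u. F (\<phi> y u m) \<partial>unif_cube D) = (\<integral>u. F (\<phi> y u M) \<partial>unif_cube D :: real)"
    and inv: "invariant_distribution S (unif_cube D) (\<lambda>y u. \<phi> y u M) \<mu>"
    and c: "\<And>l. l \<in> {1..D} \<Longrightarrow> 0 \<le> fst c l \<and> fst c l < snd c l \<and> snd c l \<le> 1"
    and coupling: "\<And>u y y'. u \<in> open_cube D \<Longrightarrow> half_open_ind D c u \<noteq> 0 \<Longrightarrow>
      y \<in> space S \<Longrightarrow> y' \<in> space S \<Longrightarrow> \<phi> y u = \<phi> y' u"
    and x0: "x0 \<in> space S"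
begin

abbreviation "h \<equiv> \<lambda>y u. \<phi> y u M"

abbreviation "p \<equiv> \<Prod>l=1..D. snd c l - fst c l"

sublocale cube_random_map D S h
proof -
  interpret prob_space "unif_cube D" by (rule prob_space_unif_cube)
  show "cube_random_map D S h"
    using \<phi>[of M] M by unfold_locales auto
qed

lemma p: "0 < p" "p \<le> 1"
proof -
  show "0 < p" using c by (intro prod_pos) auto
  show "p \<le> 1"
  proof (rule prod_le_1)
    fix l assume "l \<in> {1..D}"
    then show "0 \<le> snd c l - fst c l \<and> snd c l - fst c l \<le> 1" using c[of l] by auto
  qed
qed

lemma \<phi>_closed:
  assumes "m \<in> {1..M}" "y \<in> space S" "u \<in> open_cube D"
  shows "\<phi> y u m \<in> space S"
proof -
  have "(y, u) \<in> space (S \<Otimes>\<^sub>M unif_cube D)"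
    using assms by (simp only: space_pair_measure space_unif_cube mem_Times_iff fst_conv snd_conv)
  from measurable_space[OF \<phi>[OF assms(1)] this] show ?thesis by simp
qed

lemma recursion_closed:
  assumes "\<And>k. U k \<in> open_cube D" "y \<in> space S"
  shows "recursion h y U n \<in> space S"
  using assms M by (induction n) (auto intro!: \<phi>_closed)

lemma mp_sample_closed:
  assumes "\<And>k. U k \<in> open_cube D" "j \<in> {1..M}"
  shows "mp_sample M \<phi> x0 U i j \<in> space S"
  unfolding mp_sample_def using assms x0 by (intro \<phi>_closed recursion_closed)

text \<open>At step \<open>k\<close> the two chains meet, and common driving vectors keep them
  together afterwards.\<close>

lemma recursion_coalesce:
  assumes U: "\<And>k. U k \<in> open_cube D" and y: "y \<in> space S" "y' \<in> space S"
    and k: "1 \<le> k" "k \<le> n" "half_open_ind D c (U k) \<noteq> 0"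
  shows "recursion h y U n = recursion h y' U n"
  using k
proof (induction n)
  case (Suc n)
  show ?case
  proof (cases "k = Suc n")
    case True
    then have "\<phi> (recursion h y U n) (U (Suc n)) = \<phi> (recursion h y' U n) (U (Suc n))"
      using Suc.prems by (intro coupling U recursion_closed y) auto
    then show ?thesis by simp
  qed (use Suc in auto)
qed simp

text \<open>The state reached after \<open>i\<close> iterations plays the role of a second starting
  point next to \<open>x0\<close>, both continued with the same driving vectors.\<close>

lemma mp_sample_coalesce:
  assumes U: "\<And>k. U k \<in> open_cube D"
    and k: "1 \<le> k" "k \<le> m" "half_open_ind D c (U (i + k)) \<noteq> 0"
  shows "mp_sample M \<phi> x0 U (i + m) j = mp_sample M \<phi> x0 (\<lambda>k. U (i + k)) m j"
proof -
  define V where "V k = U (i + k)" for k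
  define y where "y = recursion h x0 U i"
  have V: "V k \<in> open_cube D" for k unfolding V_def by (rule U)
  have y: "y \<in> space S" unfolding y_def by (intro recursion_closed U x0)
  \<comment> \<open>If the hit occurs in the final iteration itself, the previous states may still
    differ, but all outputs of that iteration already agree.\<close>
  have "\<phi> (recursion h y V (m - 1)) (V m) = \<phi> (recursion h x0 V (m - 1)) (V m)"
  proof (cases "k = m")
    case True
    then show ?thesis
      using k by (intro coupling V recursion_closed y x0) (auto simp: V_def)
  next
    case False
    then show ?thesis
      using k by (subst recursion_coalesce[OF V y x0, of k]) (auto simp: V_def)
  qed
  moreover have "recursion h x0 U (i + m - 1) = recursion h y V (m - 1)"
    using recursion_shift[of h x0 U i "m - 1"] k unfolding y_def V_def by simp
  ultimately show ?thesis
    unfolding mp_sample_def V_def by simp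
qed

section \<open>The sampler restarted on a window of driving vectors\<close>

text \<open>The first \<open>m\<close> iterations act on the state through their last samples. Only
  the final one is read at \<open>j\<close>, and exchangeability replaces \<open>j\<close> by
  \<open>M\<close> there, so the mean is an iterate of the transition operator and independent of
  \<open>j\<close>.\<close>

lemma window_function_integral:
  assumes f: "f \<in> borel_measurable S" "\<And>y. y \<in> space S \<Longrightarrow> \<bar>f y\<bar> \<le> B"
    and j: "j \<in> {1..M}"
  shows "(\<lambda>w. f (mp_sample M \<phi> x0 (block D w) (Suc m) j)) \<in> borel_measurable (unif_cube (Suc m * D))"
    and "(\<integral>w. f (mp_sample M \<phi> x0 (block D w) (Suc m) j) \<partial>unif_cube (Suc m * D))
      = (transition_op (unif_cube D) h ^^ Suc m) f x0"
proof -
  have eq: "mp_sample M \<phi> x0 (block D w) (Suc m) j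
      = (\<lambda>y u. \<phi> y u j) (recursion h x0 (block D w) m) (block D w (Suc m))" for w
    by (simp add: mp_sample_def)
  have "(\<lambda>w. (recursion h x0 (block D w) m, block D w (Suc m)))
      \<in> unif_cube (Suc m * D) \<rightarrow>\<^sub>M S \<Otimes>\<^sub>M unif_cube D"
    by (intro measurable_Pair block_measurable recursion_measurable x0) auto
  from measurable_compose[OF measurable_compose[OF this \<phi>[OF j]] f(1)]
  show "(\<lambda>w. f (mp_sample M \<phi> x0 (block D w) (Suc m) j)) \<in> borel_measurable (unif_cube (Suc m * D))"
    unfolding eq by simp
  have "(\<integral>w. f (mp_sample M \<phi> x0 (block D w) (Suc m) j) \<partial>unif_cube (Suc m * D))
      = (\<integral>w. (\<integral>u. f (\<phi> (recursion h x0 (block D w) m) u j) \<partial>unif_cube D) \<partial>unif_cube (m * D))"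
    unfolding eq by (rule integral_last_block[OF x0 \<phi>[OF j] f])
  also have "\<dots> = (\<integral>w. transition_op (unif_cube D) h f (recursion h x0 (block D w) m) \<partial>unif_cube (m * D))"
    unfolding transition_op_def
    using measurable_space[OF recursion_measurable[OF x0 order_refl]]
    by (intro Bochner_Integration.integral_cong refl exchangeable j f)
  also have "\<dots> = (transition_op (unif_cube D) h ^^ m) (transition_op (unif_cube D) h f) x0"
    using f by (intro integral_recursion x0 transition_op_measurable transition_op_bounded)
  also have "\<dots> = (transition_op (unif_cube D) h ^^ Suc m) f x0"
    by (simp only: funpow_Suc_right comp_def)
  finally show "(\<integral>w. f (mp_sample M \<phi> x0 (block D w) (Suc m) j) \<partial>unif_cube (Suc m * D))
      = (transition_op (unif_cube D) h ^^ Suc m) f x0" .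
qed

lemma iterates_tend_to_mean:
  assumes f: "f \<in> borel_measurable S" "\<And>y. y \<in> space S \<Longrightarrow> \<bar>f y\<bar> \<le> B"
  shows "\<bar>(transition_op (unif_cube D) h ^^ m) f x0 - (\<integral>y. f y \<partial>\<mu>)\<bar> \<le> (1 - p) ^ m * (2 * B)"
proof (rule transition_op_iterates[OF inv f _ _ _ x0])
  show "integrable (unif_cube D) (half_open_ind D c)"
    "(\<integral>u. half_open_ind D c u \<partial>unif_cube D) = p"
    using c by (intro integral_half_open_ind; force)+
  show "half_open_ind D c u = 0 \<or> half_open_ind D c u = 1 \<and>
      (\<forall>y\<in>space S. \<forall>y'\<in>space S. h y u = h y' u)" if "u \<in> space (unif_cube D)" for u
  proof (cases "half_open_ind D c u = 0")
    case False
    have u: "u \<in> open_cube D" using that by (simp only: space_unif_cube)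
    have "half_open_ind D c u = 1" using False by (auto simp: half_open_ind_eq split: if_splits)
    then show ?thesis using coupling[OF u False] by metis
  qed simp
qed

lemma CUD_sampler_cesaro_lim:
  assumes v: "CUD v" and f: "f \<in> borel_measurable S" "\<And>y. y \<in> space S \<Longrightarrow> \<bar>f y\<bar> \<le> B"
    and j: "j \<in> {1..M}"
    and riemann: "\<And>i. i \<ge> 1 \<Longrightarrow>
        riemann_integrable (i * D) (\<lambda>w. f (mp_sample M \<phi> x0 (block D w) i j))"
  defines "u \<equiv> \<lambda>i. \<lambda>l\<in>{1..D}. v (i * D + l)"
  shows "cesaro_lim (\<lambda>i. f (mp_sample M \<phi> x0 u (Suc i) j)) (\<integral>y. f y \<partial>\<mu>)"
proof -
  define a where "a i = f (mp_sample M \<phi> x0 u (Suc i) j)" for i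
  let ?L = "\<integral>y. f y \<partial>\<mu>"
  have v01: "v i \<in> {0<..<1}" for i using v unfolding CUD_def by blast
  have u: "u i \<in> open_cube D" for i unfolding u_def open_cube_def using v01 by auto
  have B0: "0 \<le> B" using f(2)[OF x0] by linarith
  have a_bd: "\<bar>a i\<bar> \<le> B" for i
    unfolding a_def by (intro f(2) mp_sample_closed u j)
  define X where "X i = (\<Prod>l=1..D. indicator {fst c l<..snd c l} (v (i * D + l)) :: real)" for i
  have X: "half_open_ind D c (u i) = X i" for i
    unfolding half_open_ind_def X_def u_def by (intro prod.cong) auto
  \<comment> \<open>Squared deviation of the hit frequency from \<open>p\<close> over
    \<open>m\<close> consecutive driving vectors. Without a hit it equals \<open>p\<^sup>2\<close>,
    so \<open>Z m i / p\<^sup>2\<close> dominates the indicator of a miss, as in Chebyshev's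
    inequality.\<close>
  define Z where "Z m i = ((\<Sum>l<m. X (i + l) - p) / real m)\<^sup>2" for m i
  have c': "0 \<le> fst c l \<and> fst c l \<le> snd c l \<and> snd c l \<le> 1" if "l \<in> {1..D}" for l
    using c[OF that] by auto
  \<comment> \<open>The windows in question start at driving vector \<open>i + 1\<close>; this shift
    by one costs a further \<open>q\<close>, whence 3 in place of 2.\<close>
  have Z_avg: "\<forall>\<^sub>F n in sequentially. (\<Sum>i<n. Z m (i + 1)) / real n \<le> D * (3 / real m)" if m: "m \<ge> 1" for m
  proof -
    define q where "q = D / real m"
    have q: "D * (2 / real m) = 2 * q" "D * (3 / real m) = 3 * q" "0 < q"
      using D m by (simp_all add: q_def)
    have "\<bar>X k - p\<bar> \<le> 1" for k
      unfolding X_def by (rule box_deviation_le_1[OF c'])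
    then have "\<bar>\<Sum>l<m. X (i + l) - p\<bar> \<le> (\<Sum>l<m. 1)" for i
      by (intro order_trans[OF sum_abs sum_mono])
    then have "\<bar>Z m i\<bar> \<le> 1" for i
      using m unfolding Z_def by (simp add: abs_square_le_1)
    from averages_shift_diff[of "Z m", OF this, of 1]
    have "\<forall>\<^sub>F n in sequentially. - q < (\<Sum>i<n. Z m i) / real n - (\<Sum>i<n. Z m (i + 1)) / real n"
      using q(3) by (intro order_tendstoD(1)) auto
    moreover have "\<forall>\<^sub>F n in sequentially. (\<Sum>i<n. Z m i) / real n \<le> 2 * q"
      unfolding Z_def X_def q(1)[symmetric] by (rule CUD_boxes_second_moment[OF v c' D m])
    ultimately show ?thesis
      unfolding q(2) by eventually_elim linarith
  qed
  \<comment> \<open>The concatenation of the driving vectors \<open>u (i + 1)\<close> to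
    \<open>u (i + m)\<close>.\<close>
  define W where "W m i = (\<lambda>l\<in>{1..m * D}. v ((i + 1) * D + l))" for m i
  define g where "g m w = f (mp_sample M \<phi> x0 (block D w) m j)" for m w
  have block_W: "block D (W m i) k = u (i + k)" if "1 \<le> k" "k \<le> m" for m i k
    unfolding block_def u_def
  proof (intro restrict_ext)
    fix l assume "l \<in> {1..D}"
    then have "(k - 1) * D + l \<in> {1..m * D}" by (rule block_index_le[OF that])
    moreover have "(i + 1) * D + ((k - 1) * D + l) = (i + k) * D + l"
      using that(1) by (cases k) (auto simp: algebra_simps)
    ultimately show "W m i ((k - 1) * D + l) = v ((i + k) * D + l)"
      unfolding W_def by (simp only: restrict_apply if_True)
  qed
  have g_W: "g m (W m i) = f (mp_sample M \<phi> x0 (\<lambda>k. u (i + k)) m j)" if "m \<ge> 1" for m i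
  proof -
    have "recursion h x0 (block D (W m i)) (m - 1) = recursion h x0 (\<lambda>k. u (i + k)) (m - 1)"
      by (intro recursion_cong block_W) auto
    then show ?thesis
      using block_W[of m m i] that unfolding g_def mp_sample_def by simp
  qed
  have g_bd: "\<bar>g m (W m i)\<bar> \<le> B" if "m \<ge> 1" for m i
    unfolding g_W[OF that] by (intro f(2) mp_sample_closed u j)
  \<comment> \<open>The window ends with iteration \<open>i + m\<close>, whose sample is
    \<open>a (i + (m - 1))\<close> since \<open>a\<close> counts from 0. After a hit the two values
    coincide; otherwise they differ by at most \<open>2 * B\<close> and \<open>Z m (i + 1)\<close>
    equals \<open>p\<^sup>2\<close>.\<close>
  have close: "\<bar>a (i + (m - 1)) - g m (W m i)\<bar> \<le> 2 * B / p\<^sup>2 * Z m (i + 1)" if m: "m \<ge> 1" for m i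
  proof (cases "\<exists>k. 1 \<le> k \<and> k \<le> m \<and> X (i + k) \<noteq> 0")
    case True
    then obtain k where "1 \<le> k" "k \<le> m" "half_open_ind D c (u (i + k)) \<noteq> 0"
      unfolding X by blast
    from mp_sample_coalesce[of u k m i j, OF u this]
    have "a (i + (m - 1)) = g m (W m i)"
      using m unfolding a_def g_W[OF m] by simp
    then show ?thesis using B0 unfolding Z_def by simp
  next
    case False
    then have "X (i + 1 + l) = 0" if "l < m" for l
      using that by (auto elim!: allE[of _ "1 + l"] simp: add.assoc)
    then have "(\<Sum>l<m. X (i + 1 + l) - p) = (\<Sum>l<m. - p)"
      by (intro sum.cong) auto
    then have "Z m (i + 1) = p\<^sup>2"
      using m unfolding Z_def by simp
    moreover have "p\<^sup>2 \<noteq> 0" using p(1) unfolding power_eq_0_iff by linarith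
    then have "2 * B / p\<^sup>2 * p\<^sup>2 = 2 * B" by (rule nonzero_eq_divide_eq[THEN iffD1, OF _ refl])
    ultimately show ?thesis
      using a_bd[of "i + (m - 1)"] g_bd[OF m, of i] by (simp only: abs_le_iff) linarith
  qed
  \<comment> \<open>Each window starts at a multiple of \<open>D\<close>, so box frequencies of
    windows in dimension \<open>m * D\<close> come from the sparse positions, again shifted by
    one.\<close>
  have g_lim: "cesaro_lim (\<lambda>i. g m (W m i)) ((transition_op (unif_cube D) h ^^ m) f x0)" if m: "m \<ge> 1" for m
  proof -
    have "cesaro_lim (\<lambda>i. g m (W m i)) (\<integral>w. g m w \<partial>unif_cube (m * D))"
    proof (rule riemann_integrable_cesaro_lim)
      show "riemann_integrable (m * D) (g m)"
        unfolding g_def by (rule riemann[OF m])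
      show "g m \<in> borel_measurable (unif_cube (m * D))"
        unfolding g_def using window_function_integral(1)[OF f j, of "m - 1"] m by simp
      show "W m i \<in> open_cube (m * D)" for i
        unfolding W_def open_cube_def using v01 by auto
      fix b :: corners assume b: "\<And>l. l \<in> {1..m * D} \<Longrightarrow> 0 \<le> fst b l \<and> fst b l \<le> snd b l \<and> snd b l \<le> 1"
      let ?Y = "\<lambda>i. \<Prod>l=1..m * D. indicator {fst b l<..snd b l} (v (i * D + l)) :: real"
      have "cesaro_lim ?Y (\<Prod>l=1..m * D. snd b l - fst b l)"
        by (rule CUD_boxes_sparse[OF v b D])
      then have "cesaro_lim (\<lambda>i. ?Y (i + 1)) (\<Prod>l=1..m * D. snd b l - fst b l)"
        by (subst cesaro_lim_shift[of ?Y 1]) (rule prod_indicator_bounds)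
      moreover have "half_open_ind (m * D) b (W m i) = ?Y (i + 1)" for i
        unfolding half_open_ind_def W_def by (intro prod.cong) auto
      ultimately show "cesaro_lim (\<lambda>i. half_open_ind (m * D) b (W m i)) (\<Prod>l=1..m * D. snd b l - fst b l)"
        by (simp only:)
    qed
    then show ?thesis
      unfolding g_def using window_function_integral(2)[OF f j, of "m - 1"] m by simp
  qed
  have "cesaro_lim a ?L"
    unfolding cesaro_lim_def
  proof (rule LIMSEQ_I)
    fix e :: real assume e: "e > 0"
    \<comment> \<open>\<open>m\<close> is fixed before \<open>n\<close> grows: a quarter of
      \<open>e\<close> bounds the bias of the restarted chain, another the cost of windows without a
      hit. The remaining two quarters go to the averages of \<open>g m\<close> and to the shift of
      \<open>a\<close> by \<open>m - 1\<close>.\<close>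
    have "(\<lambda>m. (1 - p) ^ m * (2 * B)) \<longlonglongrightarrow> 0 * (2 * B)"
      using p by (intro tendsto_mult LIMSEQ_realpow_zero tendsto_const) auto
    then have 1: "\<forall>\<^sub>F m in sequentially. (1 - p) ^ m * (2 * B) < e / 4"
      using e by (intro order_tendstoD(2)) auto
    have 2: "\<forall>\<^sub>F m in sequentially. 2 * B / p\<^sup>2 * D * 3 / real m < e / 4"
      using e by (intro order_tendstoD(2)[OF lim_const_over_n]) auto
    obtain m where m: "m \<ge> 1" "(1 - p) ^ m * (2 * B) < e / 4" "2 * B / p\<^sup>2 * D * 3 / real m < e / 4"
      using eventually_happens'[OF _ eventually_conj[OF eventually_ge_at_top[of 1] eventually_conj[OF 1 2]]]
      by auto
    let ?E = "(transition_op (unif_cube D) h ^^ m) f x0"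
    have E: "\<bar>?E - ?L\<bar> < e / 4"
      using iterates_tend_to_mean[OF f, of m] m(2) by linarith
    have "\<forall>\<^sub>F n in sequentially. \<bar>(\<Sum>i<n. g m (W m i)) / real n - ?E\<bar> < e / 4"
      using tendstoD[OF g_lim[OF m(1), unfolded cesaro_lim_def], of "e / 4"] e by (simp add: dist_real_def)
    moreover have "\<forall>\<^sub>F n in sequentially.
        \<bar>(\<Sum>i<n. a i) / real n - (\<Sum>i<n. a (i + (m - 1))) / real n\<bar> < e / 4"
      using tendstoD[OF averages_shift_diff[of a B "m - 1"], of "e / 4"] a_bd e by (simp add: dist_real_def)
    moreover note Z_avg[OF m(1)]
    ultimately have "\<forall>\<^sub>F n in sequentially. norm ((\<Sum>i<n. a i) / real n - ?L) < e"
    proof eventually_elim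
      case (elim n)
      have "\<bar>(\<Sum>i<n. a (i + (m - 1))) - (\<Sum>i<n. g m (W m i))\<bar> \<le> (\<Sum>i<n. \<bar>a (i + (m - 1)) - g m (W m i)\<bar>)"
        unfolding sum_subtractf[symmetric] by (rule sum_abs)
      also have "\<dots> \<le> (\<Sum>i<n. 2 * B / p\<^sup>2 * Z m (i + 1))"
        by (intro sum_mono close m(1))
      also have "\<dots> = 2 * B / p\<^sup>2 * (\<Sum>i<n. Z m (i + 1))"
        by (simp only: sum_distrib_left)
      finally have "\<bar>(\<Sum>i<n. a (i + (m - 1))) - (\<Sum>i<n. g m (W m i))\<bar> / real n
          \<le> 2 * B / p\<^sup>2 * (\<Sum>i<n. Z m (i + 1)) / real n"
        by (rule divide_right_mono) simp
      also have "\<dots> = 2 * B / p\<^sup>2 * ((\<Sum>i<n. Z m (i + 1)) / real n)"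
        by (rule times_divide_eq_right[symmetric])
      also have "\<dots> \<le> 2 * B / p\<^sup>2 * (D * (3 / real m))"
        using elim(3) B0 by (intro mult_left_mono) auto
      also have "\<dots> < e / 4" using m(3) by (simp add: mult.assoc)
      finally have "\<bar>(\<Sum>i<n. a (i + (m - 1))) / real n - (\<Sum>i<n. g m (W m i)) / real n\<bar> < e / 4"
        unfolding diff_divide_distrib[symmetric] by simp
      then show ?case
        using elim(1,2) E by (simp only: real_norm_def)
    qed
    then show "\<exists>no. \<forall>n\<ge>no. norm ((\<Sum>i<n. a i) / real n - ?L) < e"
      unfolding eventually_sequentially .
  qed
  then show ?thesis unfolding a_def .
qed

end

section \<open>Consistency of the sampler driven by a CUD sequence\<close>

theorem theorem5p1:
  fixes \<Omega> :: "'d::{finite,linorder} point set"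
    and \<pi> :: "'d point \<Rightarrow> real"
    and \<kappa> :: "'d point \<Rightarrow> (nat \<Rightarrow> 'd point) \<Rightarrow> real"
    and \<Psi> :: "'d point \<Rightarrow> (nat \<Rightarrow> real) \<Rightarrow> nat \<Rightarrow> 'd point"
    and \<phi> :: "'d point \<Rightarrow> (nat \<Rightarrow> real) \<Rightarrow> nat \<Rightarrow> 'd point"
    and N M D :: nat
    and C :: "(nat \<Rightarrow> real) set"
    and v :: "nat \<Rightarrow> real"
    and u :: "nat \<Rightarrow> nat \<Rightarrow> real"
    and x0 :: "'d point"
    and x :: "nat \<Rightarrow> 'd point"
    and f :: "'d point \<Rightarrow> real"
  assumes N: "N \<ge> 1" and M: "M \<ge> 1" and D: "D = N * CARD('d) + M"
    and \<Omega>: "\<Omega> \<in> sets borel"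
    and \<pi>: "prob_density (leb_on \<Omega>) \<pi>"
    and \<kappa>_measurable: "(\<lambda>(y, z). \<kappa> y z) \<in> borel_measurable (leb_on \<Omega> \<Otimes>\<^sub>M leb_pow N \<Omega>)"
    and \<kappa>: "\<And>y. y \<in> \<Omega> \<Longrightarrow> prob_density (leb_pow N \<Omega>) (\<kappa> y)"
    and \<Psi>_measurable: "(\<lambda>(y, w). \<Psi> y w) \<in>
          leb_on \<Omega> \<Otimes>\<^sub>M unif_cube (N * CARD('d)) \<rightarrow>\<^sub>M leb_pow N \<Omega>"
    and \<Psi>: "\<And>y. y \<in> \<Omega> \<Longrightarrow> inverse_cdf N \<Omega> (\<kappa> y) (\<Psi> y)"
    and \<phi>: "\<phi> = innovation N M \<pi> \<kappa> \<Psi>"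
    and x0: "x0 \<in> \<Omega>"
    and harris: "positive_harris (leb_on \<Omega>) (unif_cube D) (\<lambda>y w. \<phi> y w M)
          (density (leb_on \<Omega>) (\<lambda>y. ennreal (\<pi> y)))"
    and regular: "regular D M \<Omega> \<phi> x0"
    and coupling: "coupling_region D \<Omega> \<phi> C"
    and v: "CUD v"
    and u: "\<And>i. u i = (\<lambda>l\<in>{1..D}. v (i * D + l))"
    and x: "\<And>i j. i \<ge> 1 \<Longrightarrow> 1 \<le> j \<Longrightarrow> j \<le> M \<Longrightarrow>
          x ((i - 1) * M + j) = mp_sample M \<phi> x0 u i j"
    and f: "continuous_on \<Omega> f" "bounded (f ` \<Omega>)"
  shows "(\<lambda>n. (1 / real n) * (\<Sum>k=1..n. f (x k))) \<longlonglongrightarrow> (LINT y:\<Omega>|lborel. f y * \<pi> y)"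
proof -
  let ?\<mu> = "density (leb_on \<Omega>) (\<lambda>y. ennreal (\<pi> y))"
  have space: "space (leb_on \<Omega>) = \<Omega>" by (simp add: space_restrict_space)
  have M_le_D: "D \<ge> 1" using M D by simp
  obtain c where c: "\<And>l. l \<in> {1..D} \<Longrightarrow> 0 \<le> fst c l \<and> fst c l < snd c l \<and> snd c l \<le> 1"
    and cC: "\<And>w. w \<in> open_cube D \<Longrightarrow> half_open_ind D c w \<noteq> 0 \<Longrightarrow> w \<in> C"
    using coupling by (rule coupling_region_box) blast
  interpret coupled_sampler D M "leb_on \<Omega>" \<phi> ?\<mu> c x0
  proof
    show "(\<lambda>z. \<phi> (fst z) (snd z) m) \<in> leb_on \<Omega> \<Otimes>\<^sub>M unif_cube D \<rightarrow>\<^sub>M leb_on \<Omega>"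
      if "m \<in> {1..M}" for m
      unfolding \<phi> by (rule innovation_measurable[OF D \<pi> \<kappa>_measurable \<kappa> \<Psi>_measurable that])
    show "(\<integral>w. F (\<phi> y w m) \<partial>unif_cube D) = (\<integral>w. F (\<phi> y w M) \<partial>unif_cube D)"
      if "m \<in> {1..M}" "y \<in> space (leb_on \<Omega>)" "F \<in> borel_measurable (leb_on \<Omega>)"
      for m y and F :: "'d point \<Rightarrow> real"
      unfolding \<phi> using that
      by (intro integral_innovation_eq[OF D \<pi> \<kappa>_measurable \<kappa> \<Psi>_measurable]) (auto simp: space)
    show "invariant_distribution (leb_on \<Omega>) (unif_cube D) (\<lambda>y w. \<phi> y w M) ?\<mu>"
      using harris unfolding positive_harris_def by blast
    show "\<phi> y w = \<phi> y' w" if "w \<in> open_cube D" "half_open_ind D c w \<noteq> 0"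
      "y \<in> space (leb_on \<Omega>)" "y' \<in> space (leb_on \<Omega>)" for w y y'
      using coupling cC that unfolding coupling_region_def space by blast
    show "x0 \<in> space (leb_on \<Omega>)" using x0 space by simp
  qed (use M M_le_D c in auto)
  obtain B where B: "\<And>y. y \<in> \<Omega> \<Longrightarrow> \<bar>f y\<bar> \<le> B"
    using f(2) unfolding bounded_iff by auto
  have f_meas: "f \<in> borel_measurable (leb_on \<Omega>)"
    using borel_measurable_continuous_on_restrict[OF f(1)]
    by (simp cong: measurable_cong_sets sets_restrict_space_cong)
  have u_eq: "u = (\<lambda>i. \<lambda>l\<in>{1..D}. v (i * D + l))" by (rule ext) (rule u)
  have u_cube: "u i \<in> open_cube D" for i
    using v unfolding u_eq open_cube_def CUD_def by auto
  have sample: "cesaro_lim (\<lambda>i. f (mp_sample M \<phi> x0 u (Suc i) j)) (\<integral>y. f y \<partial>?\<mu>)" if j: "j \<in> {1..M}" for j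
    unfolding u_eq
  proof (rule CUD_sampler_cesaro_lim[OF v f_meas _ j])
    show "\<bar>f y\<bar> \<le> B" if "y \<in> space (leb_on \<Omega>)" for y using B that space by simp
    show "riemann_integrable (i * D) (\<lambda>w. f (mp_sample M \<phi> x0 (block D w) i j))" if "i \<ge> 1" for i
      using regular f j that unfolding regular_def block_def[abs_def] by blast
  qed
  have x_eq: "x (i * M + k + 1) = mp_sample M \<phi> x0 u (Suc i) (k + 1)" if "k < M" for i k
    using x[of "Suc i" "k + 1"] that by (simp add: add.assoc)
  \<comment> \<open>The sequence of all samples interleaves the \<open>M\<close> sequences obtained
    at fixed \<open>j\<close>, which share one limit.\<close>
  have "cesaro_lim (\<lambda>k. f (x (k + 1))) (\<integral>y. f y \<partial>?\<mu>)"
  proof (rule cesaro_lim_residues[OF _ M])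
    show "\<bar>f (x (k + 1))\<bar> \<le> B" for k
    proof -
      \<comment> \<open>Every position belongs to exactly one iteration and sample index, so the
        bound on \<open>f\<close> over \<open>\<Omega>\<close> reaches the whole sequence.\<close>
      have k: "k = (k div M) * M + k mod M" "k mod M < M" using M by simp_all
      have "x (k + 1) = mp_sample M \<phi> x0 u (Suc (k div M)) (k mod M + 1)"
        using x_eq[OF k(2), of "k div M"] k(1) by simp
      also have "\<dots> \<in> \<Omega>"
        using mp_sample_closed[OF u_cube, of "k mod M + 1"] k(2) space by auto
      finally show ?thesis by (rule B)
    qed
    show "cesaro_lim (\<lambda>i. f (x (i * M + k + 1))) (\<integral>y. f y \<partial>?\<mu>)" if "k < M" for k
      using sample[of "k + 1"] that by (simp add: x_eq[OF that])
  qed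
  moreover have "(1 / real n) * (\<Sum>k=1..n. f (x k)) = (\<Sum>k<n. f (x (k + 1))) / real n" for n
  proof -
    have "(\<Sum>k=1..n. f (x k)) = (\<Sum>k<n. f (x (k + 1)))"
      by (rule sum.reindex_bij_witness[of _ "\<lambda>k. k + 1" "\<lambda>k. k - 1"]) auto
    then show ?thesis by simp
  qed
  moreover have "(\<integral>y. f y \<partial>?\<mu>) = (LINT y:\<Omega>|lborel. f y * \<pi> y)"
  proof -
    have "(\<integral>y. f y \<partial>?\<mu>) = (\<integral>y. \<pi> y * f y \<partial>leb_on \<Omega>)"
      using \<pi> f_meas unfolding prob_density_def by (subst integral_density) auto
    also have "\<dots> = (LINT y:\<Omega>|lborel. f y * \<pi> y)"
      using \<Omega> unfolding set_lebesgue_integral_def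
      by (subst integral_restrict_space) (auto simp: mult.commute)
    finally show ?thesis .
  qed
  ultimately show ?thesis
    unfolding cesaro_lim_def by (simp only:)
qed

end
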